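(* Let $0<\alpha<2$ and let $\mathbf{Y}=\{Y(t)\}_{t\in\mathbb{Z}^d}$ be a stationary $S\alpha S$ random field with integral representation $$Y(t)\stackrel{d}{=}\int_S f_t(s)\,M(ds)=\int_S c_t(s)\left(\frac{d\mu\circ\phi_t}{d\mu}(s)\right)^{1/\alpha} f\circ\phi_t(s)\,M(ds),\qquad t\in\mathbb{Z}^d,$$ where $M$ is an $S\alpha S$ random measure on a standard Borel space $(S,\mathcal{S})$ with $\sigma$-finite control measure $\mu$, $f\in L^\alpha(S,\mu)$, $\{\phi_t\}_{t\in\mathbb{Z}^d}$ is a nonsingular $\mathbb{Z}^d$-action on $(S,\mathcal{S},\mu)$ and $\{c_t\}_{t\in\mathbb{Z}^d}$ is a $\{\pm1\}$-valued measurable cocycle for $\{\phi_t\}$. Let $0<\beta<\alpha$ and $M_n=\max_{\mathbf{0}\le t\le(n-1)\mathbf{1}}|Y(t)|$. If $\mathbf{Y}$ has weak effective dimension bounded by $\theta_2$, then there is a finite constant $K'$ such that for all $n\ge1$, $$n^{-\theta_2\beta/\alpha}\,\mathbb{E}\big[M_n^\beta\big]\le K'.$$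
   Context: $d\ge1$ is an integer. For $u,v\in\mathbb{Z}^d$, $u\le v$ means coordinatewise inequality; $\mathbf{0}=(0,\dots,0)$, $\mathbf{1}=(1,\dots,1)$; maxima are over $t\in\mathbb{Z}^d$. $\stackrel{d}{=}$ between fields means equality of finite-dimensional distributions. A real-valued field is $S\alpha S$ (symmetric $\alpha$-stable) if every finite linear combination of its values has a symmetric $\alpha$-stable distribution. An $S\alpha S$ random measure $M$ with $\sigma$-finite control measure $\mu$ is an independently scattered, $\sigma$-additive random set function on sets of finite $\mu$-measure with $\mathbb{E}e^{i\theta M(A)}=e^{-|\theta|^\alpha\mu(A)}$; for $g\in L^\alpha(S,\mu)$, $\mathbb{E}\exp(i\theta\int g\,dM)=\exp(-|\theta|^\alpha\int|g|^\alpha d\mu)$. A nonsingular $\mathbb{Z}^d$-action: each $\phi_t:S\to S$ is measurable, $\phi_0=\mathrm{id}_S$, $\phi_{u+v}=\phi_u\circ\phi_v$, and each $\mu\circ\phi_t$ is equivalent to $\mu$. A $\{\pm1\}$-valued measurable cocycle: measurable maps $c_t:S\to\{\pm1\}$ with $c_{u+v}(s)=c_u(\phi_v(s))c_v(s)$. The full support condition $\bigcup_{t\in\mathbb{Z}^d}\mathrm{Support}(f\circ\phi_t)=S$ is assumed throughout. Set $$b_n=\left(\int_S\max_{\mathbf{0}\le t\le(n-1)\mathbf{1}}|f_t(s)|^\alpha\,\mu(ds)\right)^{1/\alpha}.$$ The field has weak effective dimension bounded by $\theta_2\in(0,d]$ if there exist constants $c_1>0$, $c_2>0$ and $\theta_1\in(0,\theta_2]$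 such that $c_1n^{\theta_1}\le b_n^\alpha\le c_2n^{\theta_2}$ for all sufficiently large $n$. *)

theory Defs
  imports "HOL-Probability.Probability"
begin

text \<open>The lattice \<open>\<int>\<^sup>d\<close> is \<open>int ^ 'n\<close> with \<open>d = CARD('n)\<close>; the order on it is coordinatewise and
  \<open>vec k\<close> is the point all of whose coordinates are \<open>k\<close>.\<close>

definition cube :: "nat \<Rightarrow> (int ^ 'n) set" where
  "cube n = {t. 0 \<le> t \<and> t \<le> vec (int n - 1)}"

definition standard_borel :: "'s measure \<Rightarrow> bool" where
  "standard_borel \<mu> \<longleftrightarrow>
     (\<exists>T. topspace T = space \<mu> \<and> completely_metrizable_space T \<and> separable_space T \<and>
          sets \<mu> = sigma_sets (space \<mu>) {U. openin T U})"

definition in_Lalpha :: "real \<Rightarrow> 's measure \<Rightarrow> ('s \<Rightarrow> real) \<Rightarrow> bool" where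
  "in_Lalpha \<alpha> \<mu> g \<longleftrightarrow> g \<in> borel_measurable \<mu> \<and> integrable \<mu> (\<lambda>s. \<bar>g s\<bar> powr \<alpha>)"

section \<open>Random fields\<close>

definition same_fdd ::
  "'w measure \<Rightarrow> ('i \<Rightarrow> 'w \<Rightarrow> real) \<Rightarrow> 'v measure \<Rightarrow> ('i \<Rightarrow> 'v \<Rightarrow> real) \<Rightarrow> bool" where
  "same_fdd P X Q Y \<longleftrightarrow>
     (\<forall>I. finite I \<longrightarrow>
        distr P (\<Pi>\<^sub>M i\<in>I. borel) (\<lambda>\<omega>. \<lambda>i\<in>I. X i \<omega>) =
        distr Q (\<Pi>\<^sub>M i\<in>I. borel) (\<lambda>\<omega>. \<lambda>i\<in>I. Y i \<omega>))"

definition stationary :: "'w measure \<Rightarrow> ('i::plus \<Rightarrow> 'w \<Rightarrow> real) \<Rightarrow> bool" where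
  "stationary P Y \<longleftrightarrow> (\<forall>h. same_fdd P (\<lambda>t. Y (t + h)) P Y)"

definition sas_distribution :: "real \<Rightarrow> real measure \<Rightarrow> bool" where
  "sas_distribution \<alpha> D \<longleftrightarrow>
     (\<exists>\<sigma>\<ge>0. \<forall>\<theta>. char D \<theta> = of_real (exp (- (\<sigma> powr \<alpha> * \<bar>\<theta>\<bar> powr \<alpha>))))"

definition sas_field :: "real \<Rightarrow> 'w measure \<Rightarrow> ('i \<Rightarrow> 'w \<Rightarrow> real) \<Rightarrow> bool" where
  "sas_field \<alpha> P Y \<longleftrightarrow>
     (\<forall>t. Y t \<in> borel_measurable P) \<and>
     (\<forall>I a. finite I \<longrightarrow> sas_distribution \<alpha> (distr P borel (\<lambda>\<omega>. \<Sum>t\<in>I. a t * Y t \<omega>)))"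

section \<open>Stable random measures and stable integrals\<close>

definition sas_random_measure ::
  "real \<Rightarrow> 's measure \<Rightarrow> 'w measure \<Rightarrow> ('s set \<Rightarrow> 'w \<Rightarrow> real) \<Rightarrow> bool" where
  "sas_random_measure \<alpha> \<mu> P M \<longleftrightarrow>
     (\<forall>A\<in>fmeasurable \<mu>. M A \<in> borel_measurable P) \<and>
     (\<forall>A\<in>fmeasurable \<mu>. \<forall>\<theta>.
        char (distr P borel (M A)) \<theta> = of_real (exp (- (\<bar>\<theta>\<bar> powr \<alpha> * measure \<mu> A)))) \<and>
     (\<forall>(A :: nat \<Rightarrow> 's set) k.
        A ` {..<k} \<subseteq> fmeasurable \<mu> \<and> disjoint_family_on A {..<k} \<longrightarrow>
        prob_space.indep_vars P (\<lambda>_. borel) (\<lambda>i. M (A i)) {..<k}) \<and>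
     (\<forall>A :: nat \<Rightarrow> 's set.
        range A \<subseteq> fmeasurable \<mu> \<and> disjoint_family A \<and> (\<Union>i. A i) \<in> fmeasurable \<mu> \<longrightarrow>
        (AE \<omega> in P. (\<lambda>i. M (A i) \<omega>) sums M (\<Union>i. A i) \<omega>))"

text \<open>The integral of a simple function whose support has finite measure. The value \<open>0\<close> is left
  out because its level set may have infinite measure.\<close>

definition simple_stable_integral ::
  "'s measure \<Rightarrow> ('s set \<Rightarrow> 'w \<Rightarrow> real) \<Rightarrow> ('s \<Rightarrow> real) \<Rightarrow> 'w \<Rightarrow> real" where
  "simple_stable_integral \<mu> M h \<omega> =
     (\<Sum>y\<in>h ` space \<mu> - {0}. y * M {s \<in> space \<mu>. h s = y} \<omega>)"

definition converges_in_prob ::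
  "'w measure \<Rightarrow> (nat \<Rightarrow> 'w \<Rightarrow> real) \<Rightarrow> ('w \<Rightarrow> real) \<Rightarrow> bool" where
  "converges_in_prob P Z X \<longleftrightarrow>
     (\<forall>\<epsilon>>0. (\<lambda>k. measure P {\<omega> \<in> space P. \<epsilon> < \<bar>Z k \<omega> - X \<omega>\<bar>}) \<longlonglongrightarrow> 0)"

text \<open>\<open>X\<close> is a version of \<open>\<integral> g dM\<close>: the integral is the limit in probability of the integrals of
  simple functions converging to \<open>g\<close> in \<open>L\<^sup>\<alpha>\<close>, hence determined only almost surely.\<close>

definition is_stable_integral ::
  "real \<Rightarrow> 's measure \<Rightarrow> 'w measure \<Rightarrow> ('s set \<Rightarrow> 'w \<Rightarrow> real) \<Rightarrow> ('s \<Rightarrow> real) \<Rightarrow> ('w \<Rightarrow> real) \<Rightarrow> bool"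
  where
  "is_stable_integral \<alpha> \<mu> P M g X \<longleftrightarrow>
     in_Lalpha \<alpha> \<mu> g \<and> X \<in> borel_measurable P \<and>
     (\<exists>h :: nat \<Rightarrow> 's \<Rightarrow> real.
        (\<forall>k. simple_function \<mu> (h k) \<and> {s \<in> space \<mu>. h k s \<noteq> 0} \<in> fmeasurable \<mu>) \<and>
        (\<lambda>k. \<integral>\<^sup>+ s. ennreal (\<bar>h k s - g s\<bar> powr \<alpha>) \<partial>\<mu>) \<longlonglongrightarrow> 0 \<and>
        converges_in_prob P (\<lambda>k. simple_stable_integral \<mu> M (h k)) X)"

section \<open>Nonsingular actions and cocycles\<close>

text \<open>The measure \<open>\<mu> \<circ> \<phi>\<^sub>t\<close>, that is \<open>A \<mapsto> \<mu> (\<phi>\<^sub>t ` A)\<close>, written as a push-forward along the inverse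
  \<open>\<phi>\<^sub>-\<^sub>t\<close> of \<open>\<phi>\<^sub>t\<close>; see \<open>emeasure_shifted_measure\<close> below.\<close>

definition shifted_measure :: "'s measure \<Rightarrow> ('i::uminus \<Rightarrow> 's \<Rightarrow> 's) \<Rightarrow> 'i \<Rightarrow> 's measure" where
  "shifted_measure \<mu> \<phi> t = distr \<mu> \<mu> (\<phi> (- t))"

definition nonsingular_action :: "'s measure \<Rightarrow> ('i::ab_group_add \<Rightarrow> 's \<Rightarrow> 's) \<Rightarrow> bool" where
  "nonsingular_action \<mu> \<phi> \<longleftrightarrow>
     (\<forall>t. \<phi> t \<in> measurable \<mu> \<mu>) \<and>
     (\<forall>s\<in>space \<mu>. \<phi> 0 s = s) \<and>
     (\<forall>u v. \<forall>s\<in>space \<mu>. \<phi> (u + v) s = \<phi> u (\<phi> v s)) \<and>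
     (\<forall>t. absolutely_continuous \<mu> (shifted_measure \<mu> \<phi> t) \<and>
          absolutely_continuous (shifted_measure \<mu> \<phi> t) \<mu>)"

lemma emeasure_shifted_measure:
  assumes "nonsingular_action \<mu> \<phi>" and A: "A \<in> sets \<mu>"
  shows "emeasure (shifted_measure \<mu> \<phi> t) A = emeasure \<mu> (\<phi> t ` A)"
proof -
  have meas: "\<phi> u \<in> measurable \<mu> \<mu>" for u
    using assms(1) by (simp add: nonsingular_action_def)
  have comp: "\<phi> u (\<phi> v s) = \<phi> (u + v) s" and zero: "\<phi> 0 s = s" if "s \<in> space \<mu>" for u v s
    using assms(1) that by (simp_all add: nonsingular_action_def)
  have inv: "\<phi> t (\<phi> (- t) s) = s" "\<phi> (- t) (\<phi> t s) = s" if "s \<in> space \<mu>" for s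
    using comp[OF that] zero[OF that] by simp_all
  have sub: "A \<subseteq> space \<mu>"
    using A by (rule sets.sets_into_space)
  have "\<phi> (- t) -` A \<inter> space \<mu> = \<phi> t ` A"
  proof (intro equalityI subsetI)
    fix s assume s: "s \<in> \<phi> (- t) -` A \<inter> space \<mu>"
    then have "s = \<phi> t (\<phi> (- t) s)" using inv(1) by simp
    then show "s \<in> \<phi> t ` A" using s by blast
  next
    fix s assume "s \<in> \<phi> t ` A"
    then obtain a where a: "a \<in> A" "s = \<phi> t a" by blast
    then show "s \<in> \<phi> (- t) -` A \<inter> space \<mu>"
      using sub inv(2)[of a] measurable_space[OF meas, of a t] by auto
  qed
  then show ?thesis
    using emeasure_distr[OF meas[of "- t"] A] by (simp add: shifted_measure_def)
qed

definition sign_cocycle ::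
  "'s measure \<Rightarrow> ('i::plus \<Rightarrow> 's \<Rightarrow> 's) \<Rightarrow> ('i \<Rightarrow> 's \<Rightarrow> real) \<Rightarrow> bool" where
  "sign_cocycle \<mu> \<phi> c \<longleftrightarrow>
     (\<forall>t. c t \<in> borel_measurable \<mu>) \<and>
     (\<forall>t. \<forall>s\<in>space \<mu>. c t s \<in> {1, -1}) \<and>
     (\<forall>u v. \<forall>s\<in>space \<mu>. c (u + v) s = c u (\<phi> v s) * c v s)"

text \<open>Supports are understood modulo \<open>\<mu>\<close>-null sets, since \<open>f\<close> is an element of \<open>L\<^sup>\<alpha>\<close>.\<close>

definition full_support :: "'s measure \<Rightarrow> ('i \<Rightarrow> 's \<Rightarrow> 's) \<Rightarrow> ('s \<Rightarrow> real) \<Rightarrow> bool" where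
  "full_support \<mu> \<phi> f \<longleftrightarrow> (AE s in \<mu>. \<exists>t. f (\<phi> t s) \<noteq> 0)"

definition action_kernel ::
  "real \<Rightarrow> 's measure \<Rightarrow> ('i::uminus \<Rightarrow> 's \<Rightarrow> 's) \<Rightarrow> ('i \<Rightarrow> 's \<Rightarrow> real) \<Rightarrow> ('s \<Rightarrow> real) \<Rightarrow> 'i \<Rightarrow> 's \<Rightarrow> real"
  where
  "action_kernel \<alpha> \<mu> \<phi> c f t s =
     c t s * enn2real (RN_deriv \<mu> (shifted_measure \<mu> \<phi> t) s) powr (1 / \<alpha>) * f (\<phi> t s)"

section \<open>Effective dimension and partial maxima\<close>

definition b_seq :: "real \<Rightarrow> 's measure \<Rightarrow> (int ^ 'n \<Rightarrow> 's \<Rightarrow> real) \<Rightarrow> nat \<Rightarrow> real" where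
  "b_seq \<alpha> \<mu> k n = (\<integral>s. Max ((\<lambda>t. \<bar>k t s\<bar> powr \<alpha>) ` cube n) \<partial>\<mu>) powr (1 / \<alpha>)"

definition weak_effective_dimension_le ::
  "real \<Rightarrow> 's measure \<Rightarrow> (int ^ 'n \<Rightarrow> 's \<Rightarrow> real) \<Rightarrow> real \<Rightarrow> bool" where
  "weak_effective_dimension_le \<alpha> \<mu> (k :: int ^ 'n \<Rightarrow> 's \<Rightarrow> real) \<theta>\<^sub>2 \<longleftrightarrow>
     0 < \<theta>\<^sub>2 \<and> \<theta>\<^sub>2 \<le> real CARD('n) \<and>
     (\<exists>c\<^sub>1 c\<^sub>2 \<theta>\<^sub>1. 0 < c\<^sub>1 \<and> 0 < c\<^sub>2 \<and> 0 < \<theta>\<^sub>1 \<and> \<theta>\<^sub>1 \<le> \<theta>\<^sub>2 \<and>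
        (\<forall>\<^sub>F n in sequentially.
           c\<^sub>1 * real n powr \<theta>\<^sub>1 \<le> b_seq \<alpha> \<mu> k n powr \<alpha> \<and>
           b_seq \<alpha> \<mu> k n powr \<alpha> \<le> c\<^sub>2 * real n powr \<theta>\<^sub>2))"

definition partial_max :: "(int ^ 'n \<Rightarrow> 'w \<Rightarrow> real) \<Rightarrow> nat \<Rightarrow> 'w \<Rightarrow> real" where
  "partial_max Y n \<omega> = Max ((\<lambda>t. \<bar>Y t \<omega>\<bar>) ` cube n)"

end

theory Submission
  imports Defs
begin

text \<open>
  Write \<open>f\<^sub>t\<close> for the kernel, \<open>B\<close> for a multiple of \<open>n powr \<theta>\<^sub>2\<close> that dominates \<open>b\<^sub>n\<close> to the power
  \<open>\<alpha>\<close> for every \<open>n \<ge> 1\<close>, and \<open>d\<close> for the dimension of the lattice. The bound on the moments follows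
  by summing over dyadic levels (\<open>moment_bound_from_tail\<close>) once the tails satisfy
  \<open>P (M\<^sub>n > \<lambda> n powr (\<theta>\<^sub>2 / \<alpha>)) \<le> K \<lambda> powr (- \<alpha>)\<close> for all \<open>\<lambda> \<ge> 1\<close> with \<open>K\<close> independent of \<open>n\<close>;
  the condition \<open>\<beta> < \<alpha>\<close> makes the dyadic series converge.

  For the tails, approximate the integrals over the cube by integrals of simple functions on a
  common partition, so that \<open>Y t\<close> becomes \<open>\<Sum>j. x\<^sub>t\<^sub>j Z\<^sub>j\<close> with independent symmetric stable
  \<open>Z\<^sub>j\<close> whose scales are the measures \<open>w\<^sub>j\<close> of the cells. Put \<open>m\<^sub>j = max\<^sub>t \<bar>x\<^sub>t\<^sub>j\<bar>\<close> and let \<open>L\<close> be the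
  level to be exceeded. Truncate \<open>Z\<^sub>j\<close> where \<open>m\<^sub>j \<bar>Z\<^sub>j\<bar>\<close> exceeds \<open>L / q\<close>.

  The probability that some truncation takes effect is at most a constant times
  \<open>(\<Sum>j. m\<^sub>j powr \<alpha> * w\<^sub>j) * L powr (- \<alpha>)\<close>, and this sum is the integral of \<open>max\<^sub>t \<bar>f\<^sub>t\<bar> powr \<alpha>\<close>, hence
  at most \<open>B\<close>. If none does, every sum has terms of size at most \<open>L / q\<close> and, because
  \<open>\<bar>x\<^sub>t\<^sub>j\<bar> \<le> m\<^sub>j\<close> and \<open>\<alpha> < 2\<close>, a variance relative to \<open>L\<^sup>2\<close> of order
  \<open>L powr (- \<alpha>)\<close> times the integral of \<open>\<bar>f\<^sub>t\<bar> powr \<alpha>\<close>. That integral does not grow with \<open>t\<close>, since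
  the action only transports mass (\<open>action_kernel_norm_le\<close>). An exponential inequality of Bennett
  type (\<open>bennett\<close>) turns the smallness of the variance into a power: the sum at a single \<open>t\<close> exceeds
  \<open>L\<close> with probability of order \<open>L powr (- \<alpha> * q)\<close>. For \<open>L = \<lambda> n powr (\<theta>\<^sub>2 / \<alpha>)\<close> and
  \<open>q = d / \<theta>\<^sub>2\<close> this is \<open>n powr (- d) * \<lambda> powr (- \<alpha> * q)\<close>, which beats the number \<open>n ^ d\<close> of points
  in the cube, and \<open>q \<ge> 1\<close> because \<open>\<theta>\<^sub>2 \<le> d\<close>. The resulting bound for finitely many stable variables
  is \<open>stable_vector_max_tail\<close>; it passes to the integrals in \<open>stable_integral_max_tail\<close>.
\<close>

section \<open>Symmetric stable variables\<close>

text \<open>The right-hand side is, up to the factor, the average of \<open>1 - cos (\<theta> * y)\<close> over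
  \<open>\<theta> \<in> {0..1}\<close>. Averaging is what makes the bound hold for large \<open>y\<close>, where \<open>1 - cos y\<close> itself
  vanishes repeatedly.\<close>

lemma min_one_square_le_sinc:
  fixes y :: real
  shows "min 1 (y\<^sup>2) \<le> 8 * (1 - sinc y)"
proof -
  have pos: "min 1 (y\<^sup>2) \<le> 8 * (1 - sin y / y)" if y: "0 < y" for y :: real
  proof (cases "y \<le> 2")
    case True
    have "\<bar>sin y - (\<Sum>m<5. sin_coeff m * y ^ m)\<bar> \<le> inverse (fact 5) * \<bar>y\<bar> ^ 5"
      by (rule Maclaurin_sin_bound)
    then have "sin y \<le> y - y^3/6 + y^5/120"
      using y by (simp add: sin_coeff_def lessThan_nat_numeral fact_numeral abs_if split: if_splits)
    moreover have "y^5/120 \<le> y^3/30"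
    proof -
      have "y^5 = y^3 * y\<^sup>2" by (simp add: eval_nat_numeral)
      also have "\<dots> \<le> y^3 * 4"
        using True y power_mono[of y 2 2] by (intro mult_left_mono) auto
      finally show ?thesis by simp
    qed
    ultimately have "sin y \<le> y - y^3 * (2/15)" by simp
    then have "sin y / y \<le> (y - y^3 * (2/15)) / y"
      using y by (intro divide_right_mono) auto
    also have "\<dots> = 1 - y\<^sup>2 * (2/15)"
      using y by (simp add: field_simps eval_nat_numeral)
    finally have "16 / 15 * y\<^sup>2 \<le> 8 * (1 - sin y / y)" by simp
    moreover have "min 1 (y\<^sup>2) \<le> y\<^sup>2" "y\<^sup>2 \<le> 16 / 15 * y\<^sup>2" by simp_all
    ultimately show ?thesis by linarith
  next
    case False
    have "sin y / y \<le> 1 / y" using y by (intro divide_right_mono) auto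
    also have "\<dots> \<le> 1/2" using False by (simp add: field_simps)
    finally show ?thesis by (auto simp: min_def)
  qed
  consider "y = 0" | "0 < y" | "y < 0" by linarith
  then show ?thesis
    using pos[of y] pos[of "- y"] by cases auto
qed

lemma nn_integral_one_minus_cos:
  fixes y :: real
  shows "(\<integral>\<^sup>+ \<theta>. ennreal (1 - cos (\<theta> * y)) * indicator {0..1} \<theta> \<partial>lborel) = ennreal (1 - sinc y)"
proof (cases "y = 0")
  case False
  have "(\<integral>\<^sup>+ \<theta>. ennreal (1 - cos (\<theta> * y)) * indicator {0..1} \<theta> \<partial>lborel)
      = ennreal ((1 - sin (1 * y) / y) - (0 - sin (0 * y) / y))"
    by (rule nn_integral_FTC_Icc) (use False in \<open>auto intro!: derivative_eq_intros\<close>)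
  then show ?thesis using False by simp
qed simp

text \<open>Integrate \<open>min_one_square_le_sinc\<close> over the distribution of \<open>Z\<close>: by Fubini the result is an average
  of \<open>1 - Re \<phi>(\<theta> u)\<close> with \<open>\<phi>\<close> the characteristic function, and \<open>1 - exp (- x) \<le> x\<close> finishes. One
  estimate thus controls both the tail of \<open>Z\<close> and the second moment of its truncation.\<close>

lemma stable_truncated_moment:
  assumes "prob_space Q" and Z[measurable]: "Z \<in> borel_measurable Q"
    and char: "\<And>\<theta>. char (distr Q borel Z) \<theta> = of_real (exp (- (\<bar>\<theta>\<bar> powr \<alpha> * w)))"
    and "0 < \<alpha>" "0 \<le> w"
  shows "(\<integral>\<omega>. min 1 ((u * Z \<omega>)\<^sup>2) \<partial>Q) \<le> 8 * w * \<bar>u\<bar> powr \<alpha>"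
proof -
  interpret prob_space Q by fact
  interpret pair_sigma_finite lborel Q ..
  have cos: "(\<integral>\<omega>. cos (r * Z \<omega>) \<partial>Q) = exp (- (\<bar>r\<bar> powr \<alpha> * w))" for r
  proof -
    have int: "integrable Q (\<lambda>\<omega>. iexp (r * Z \<omega>))"
      by (rule integrable_const_bound[where B = 1]) auto
    have "exp (- (\<bar>r\<bar> powr \<alpha> * w)) = Re (char (distr Q borel Z) r)"
      unfolding char by simp
    also have "char (distr Q borel Z) r = (CLINT \<omega>|Q. iexp (r * Z \<omega>))"
      unfolding char_def by (subst integral_distr) auto
    also have "Re \<dots> = (\<integral>\<omega>. cos (r * Z \<omega>) \<partial>Q)"
      unfolding integral_Re[OF int, symmetric] by (simp add: Re_exp)
    finally show ?thesis by simp
  qed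
  have "(\<integral>\<^sup>+\<omega>. ennreal (1 - sinc (u * Z \<omega>)) \<partial>Q)
     = (\<integral>\<^sup>+\<omega>. (\<integral>\<^sup>+ \<theta>. ennreal (1 - cos (\<theta> * (u * Z \<omega>))) * indicator {0..1} \<theta> \<partial>lborel) \<partial>Q)"
    by (simp only: nn_integral_one_minus_cos)
  also have "\<dots> = (\<integral>\<^sup>+ \<theta>. (\<integral>\<^sup>+\<omega>. ennreal (1 - cos (\<theta> * (u * Z \<omega>))) * indicator {0..1} \<theta> \<partial>Q) \<partial>lborel)"
    by (rule Fubini') measurable
  also have "\<dots> \<le> (\<integral>\<^sup>+ \<theta>. ennreal (w * \<bar>u\<bar> powr \<alpha>) * indicator {0..1::real} \<theta> \<partial>lborel)"
  proof (intro nn_integral_mono)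
    fix \<theta> :: real
    show "(\<integral>\<^sup>+\<omega>. ennreal (1 - cos (\<theta> * (u * Z \<omega>))) * indicator {0..1} \<theta> \<partial>Q)
        \<le> ennreal (w * \<bar>u\<bar> powr \<alpha>) * indicator {0..1} \<theta>"
    proof (cases "\<theta> \<in> {0..1}")
      case True
      have int: "integrable Q (\<lambda>\<omega>. cos ((\<theta> * u) * Z \<omega>))"
        by (rule integrable_const_bound[where B = 1]) auto
      have "(\<integral>\<^sup>+\<omega>. ennreal (1 - cos ((\<theta> * u) * Z \<omega>)) \<partial>Q)
          = ennreal (\<integral>\<omega>. 1 - cos ((\<theta> * u) * Z \<omega>) \<partial>Q)"
        using int by (intro nn_integral_eq_integral) auto
      moreover have "(\<integral>\<omega>. 1 - cos ((\<theta> * u) * Z \<omega>) \<partial>Q) = 1 - exp (- (\<bar>\<theta> * u\<bar> powr \<alpha> * w))"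
        using int by (simp add: cos prob_space)
      moreover have "1 - exp (- (\<bar>\<theta> * u\<bar> powr \<alpha> * w)) \<le> \<bar>\<theta> * u\<bar> powr \<alpha> * w"
        using exp_ge_add_one_self[of "- (\<bar>\<theta> * u\<bar> powr \<alpha> * w)"] by simp
      moreover have "\<dots> \<le> \<bar>u\<bar> powr \<alpha> * w"
        using True assms by (intro mult_right_mono powr_mono2) (auto simp: abs_mult mult_left_le_one_le)
      ultimately have "(\<integral>\<^sup>+\<omega>. ennreal (1 - cos ((\<theta> * u) * Z \<omega>)) \<partial>Q) \<le> ennreal (\<bar>u\<bar> powr \<alpha> * w)"
        by (simp add: ennreal_leI)
      then show ?thesis using True by (simp add: mult_ac)
    qed auto
  qed
  also have "\<dots> = ennreal (w * \<bar>u\<bar> powr \<alpha>)"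
    by (subst nn_integral_cmult) auto
  finally have sinc: "(\<integral>\<^sup>+\<omega>. ennreal (1 - sinc (u * Z \<omega>)) \<partial>Q) \<le> ennreal (w * \<bar>u\<bar> powr \<alpha>)" .
  have "ennreal (\<integral>\<omega>. min 1 ((u * Z \<omega>)\<^sup>2) \<partial>Q) = (\<integral>\<^sup>+\<omega>. ennreal (min 1 ((u * Z \<omega>)\<^sup>2)) \<partial>Q)"
    by (intro nn_integral_eq_integral[symmetric] integrable_const_bound[where B = 1]) auto
  also have "\<dots> \<le> (\<integral>\<^sup>+\<omega>. 8 * ennreal (1 - sinc (u * Z \<omega>)) \<partial>Q)"
  proof (intro nn_integral_mono)
    fix \<omega>
    show "ennreal (min 1 ((u * Z \<omega>)\<^sup>2)) \<le> 8 * ennreal (1 - sinc (u * Z \<omega>))"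
      using ennreal_leI[OF min_one_square_le_sinc[of "u * Z \<omega>"]]
      by (subst (asm) ennreal_mult') (simp_all only: ennreal_numeral zero_le_numeral)
  qed
  also have "\<dots> = 8 * (\<integral>\<^sup>+\<omega>. ennreal (1 - sinc (u * Z \<omega>)) \<partial>Q)"
    by (rule nn_integral_cmult) measurable
  also have "\<dots> \<le> 8 * ennreal (w * \<bar>u\<bar> powr \<alpha>)"
    by (rule mult_left_mono[OF sinc]) simp
  also have "\<dots> = ennreal (8 * w * \<bar>u\<bar> powr \<alpha>)"
    using assms by (simp add: ennreal_mult' mult.assoc)
  finally show ?thesis
    using assms by (subst (asm) ennreal_le_iff) auto
qed

lemma stable_tail:
  assumes "prob_space Q" and Z[measurable]: "Z \<in> borel_measurable Q"
    and char: "\<And>\<theta>. char (distr Q borel Z) \<theta> = of_real (exp (- (\<bar>\<theta>\<bar> powr \<alpha> * w)))"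
    and "0 < \<alpha>" "0 \<le> w" "0 < a"
  shows "measure Q {\<omega> \<in> space Q. a < \<bar>Z \<omega>\<bar>} \<le> 8 * w * a powr (- \<alpha>)"
proof -
  interpret prob_space Q by fact
  have "measure Q {\<omega> \<in> space Q. a < \<bar>Z \<omega>\<bar>} = (\<integral>\<omega>. indicator {\<omega> \<in> space Q. a < \<bar>Z \<omega>\<bar>} \<omega> \<partial>Q)"
    by (subst Bochner_Integration.integral_indicator) (auto intro!: arg_cong[where f = "measure Q"])
  also have "\<dots> \<le> (\<integral>\<omega>. min 1 (((1/a) * Z \<omega>)\<^sup>2) \<partial>Q)"
  proof (intro integral_mono)
    fix \<omega> assume "\<omega> \<in> space Q"
    have "1 \<le> (Z \<omega> / a)\<^sup>2" if "a < \<bar>Z \<omega>\<bar>"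
      using that \<open>0 < a\<close> abs_le_square_iff[of 1 "Z \<omega> / a"] by simp
    then show "indicator {\<omega> \<in> space Q. a < \<bar>Z \<omega>\<bar>} \<omega> \<le> min 1 (((1/a) * Z \<omega>)\<^sup>2)"
      by (auto simp: indicator_def min_def)
  qed (auto intro!: integrable_const_bound[where B = 1])
  also have "\<dots> \<le> 8 * w * \<bar>1/a\<bar> powr \<alpha>"
    by (rule stable_truncated_moment[OF assms(1-5)])
  also have "\<bar>1/a\<bar> powr \<alpha> = a powr (- \<alpha>)"
    using \<open>0 < a\<close> by (simp add: powr_minus inverse_powr divide_inverse)
  finally show ?thesis .
qed

lemma stable_symmetric:
  assumes "prob_space Q" and Z[measurable]: "Z \<in> borel_measurable Q"
    and char: "\<And>\<theta>. char (distr Q borel Z) \<theta> = of_real (exp (- (\<bar>\<theta>\<bar> powr \<alpha> * w)))"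
  shows "distr Q borel (\<lambda>\<omega>. - Z \<omega>) = distr Q borel Z"
proof -
  interpret prob_space Q by fact
  have "char (distr Q borel (\<lambda>\<omega>. - Z \<omega>)) \<theta> = char (distr Q borel Z) (- \<theta>)" for \<theta>
    unfolding char_def by (simp add: integral_distr)
  then have "char (distr Q borel (\<lambda>\<omega>. - Z \<omega>)) = char (distr Q borel Z)"
    by (simp add: fun_eq_iff char)
  moreover have "real_distribution (distr Q borel (\<lambda>\<omega>. - Z \<omega>))" "real_distribution (distr Q borel Z)"
    by (auto intro!: real_distribution_distr)
  ultimately show ?thesis by (intro Levy_uniqueness)
qed

lemma stable_truncated_mean:
  assumes "prob_space Q" and Z[measurable]: "Z \<in> borel_measurable Q"
    and char: "\<And>\<theta>. char (distr Q borel Z) \<theta> = of_real (exp (- (\<bar>\<theta>\<bar> powr \<alpha> * w)))"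
  shows "(\<integral>\<omega>. (if \<bar>Z \<omega>\<bar> \<le> a then Z \<omega> else 0) \<partial>Q) = 0"
proof -
  let ?g = "\<lambda>z::real. if \<bar>z\<bar> \<le> a then z else 0"
  have "(\<integral>\<omega>. ?g (Z \<omega>) \<partial>Q) = (\<integral>z. ?g z \<partial>distr Q borel Z)"
    by (subst integral_distr) auto
  also have "\<dots> = (\<integral>z. ?g z \<partial>distr Q borel (\<lambda>\<omega>. - Z \<omega>))"
    by (simp only: stable_symmetric[OF assms])
  also have "\<dots> = (\<integral>\<omega>. ?g (- Z \<omega>) \<partial>Q)"
    by (subst integral_distr) auto
  also have "\<dots> = (\<integral>\<omega>. - ?g (Z \<omega>) \<partial>Q)"
    by (rule Bochner_Integration.integral_cong) auto
  also have "\<dots> = - (\<integral>\<omega>. ?g (Z \<omega>) \<partial>Q)" by simp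
  finally show ?thesis by simp
qed

section \<open>A Bennett inequality\<close>

text \<open>All terms of the exponential series from the quadratic one on carry a factor \<open>w\<^sup>2\<close>, and what
  remains of them is dominated by the series at \<open>s\<close>.\<close>

lemma exp_mult_le_quadratic:
  fixes s w :: real
  assumes "0 \<le> s" "\<bar>w\<bar> \<le> 1"
  shows "exp (s * w) \<le> 1 + s * w + w\<^sup>2 * exp s"
proof -
  have exp_split: "exp x = (\<Sum>k. x ^ (k + 2) / fact (k + 2)) + (1 + x)" for x :: real
  proof -
    have "summable (\<lambda>k. x ^ k / fact k)"
      using summable_exp_generic[of x] by (simp add: divide_inverse mult.commute)
    then have "(\<Sum>k. x ^ k / fact k) = (\<Sum>k. x ^ (k + 2) / fact (k + 2)) + (\<Sum>k<2. x ^ k / fact k)"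
      by (rule suminf_split_initial_segment)
    then show ?thesis
      by (simp add: exp_def divide_inverse mult.commute numeral_2_eq_2)
  qed
  have sm: "summable (\<lambda>k. x ^ (k + 2) / fact (k + 2))" for x :: real
    using summable_exp_generic[of x]
    by (subst summable_iff_shift) (simp add: divide_inverse mult.commute)
  have "(\<Sum>k. (s * w) ^ (k + 2) / fact (k + 2)) \<le> (\<Sum>k. w\<^sup>2 * (s ^ (k + 2) / fact (k + 2)))"
  proof (rule suminf_le)
    fix k
    have "w ^ k \<le> 1"
      using power_le_one[of "\<bar>w\<bar>" k] assms(2) by (simp add: power_abs[symmetric] abs_le_iff)
    then have "s ^ (k + 2) * (w\<^sup>2 * w ^ k) \<le> s ^ (k + 2) * (w\<^sup>2 * 1)"
      using assms(1) by (intro mult_left_mono) auto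
    then have "(s * w) ^ (k + 2) / fact (k + 2) \<le> s ^ (k + 2) * w\<^sup>2 / fact (k + 2)"
      by (intro divide_right_mono) (simp_all add: power_mult_distrib power_add power2_eq_square mult_ac)
    then show "(s * w) ^ (k + 2) / fact (k + 2) \<le> w\<^sup>2 * (s ^ (k + 2) / fact (k + 2))"
      by (simp add: mult.commute)
  qed (rule sm, rule summable_mult[OF sm])
  also have "\<dots> = w\<^sup>2 * (exp s - (1 + s))"
    using exp_split[of s] by (subst suminf_mult[OF sm]) simp
  also have "\<dots> \<le> w\<^sup>2 * exp s"
    using assms(1) by (intro mult_left_mono) auto
  finally show ?thesis using exp_split[of "s * w"] by simp
qed

lemma (in prob_space) exp_moment_bounded_centred:
  assumes W[measurable]: "W \<in> borel_measurable M" and bounded: "\<And>\<omega>. \<bar>W \<omega>\<bar> \<le> (1::real)"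
    and mean: "expectation W = 0" and "0 \<le> s"
  shows "(\<integral>\<^sup>+\<omega>. ennreal (exp (s * W \<omega>)) \<partial>M) \<le> ennreal (exp (expectation (\<lambda>\<omega>. (W \<omega>)\<^sup>2) * exp s))"
proof -
  have int: "integrable M W"
    by (rule integrable_const_bound[where B = 1]) (auto simp: bounded)
  have int2: "integrable M (\<lambda>\<omega>. (W \<omega>)\<^sup>2)"
    by (rule integrable_const_bound[where B = 1])
       (use bounded in \<open>auto simp: abs_square_le_1\<close>)
  have le: "exp (s * W \<omega>) \<le> 1 + s * W \<omega> + (W \<omega>)\<^sup>2 * exp s" for \<omega>
    by (rule exp_mult_le_quadratic[OF \<open>0 \<le> s\<close> bounded])
  have "(\<integral>\<^sup>+\<omega>. ennreal (exp (s * W \<omega>)) \<partial>M) \<le> (\<integral>\<^sup>+\<omega>. ennreal (1 + s * W \<omega> + (W \<omega>)\<^sup>2 * exp s) \<partial>M)"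
    by (intro nn_integral_mono ennreal_leI le)
  also have "\<dots> = ennreal (\<integral>\<omega>. 1 + s * W \<omega> + (W \<omega>)\<^sup>2 * exp s \<partial>M)"
    using int int2 by (intro nn_integral_eq_integral AE_I2 order.trans[OF exp_ge_zero le]) auto
  also have "(\<integral>\<omega>. 1 + s * W \<omega> + (W \<omega>)\<^sup>2 * exp s \<partial>M) = 1 + expectation (\<lambda>\<omega>. (W \<omega>)\<^sup>2) * exp s"
    using int int2 by (simp add: mean prob_space)
  also have "\<dots> \<le> exp (expectation (\<lambda>\<omega>. (W \<omega>)\<^sup>2) * exp s)"
    by (rule exp_ge_add_one_self)
  finally show ?thesis by (simp add: ennreal_leI)
qed

text \<open>Chernoff's method: independence bounds the exponential moment at \<open>s\<close> by \<open>exp (v * exp s)\<close>, and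
  \<open>s = ln (1 / v)\<close> makes this the constant \<open>exp 1\<close> while \<open>exp (- s * q)\<close> becomes \<open>v powr q\<close>. The
  power of \<open>v\<close> is the point: choosing \<open>q\<close> large yields as much decay as a union bound requires.\<close>

lemma (in prob_space) bennett_one_sided:
  fixes W :: "'i \<Rightarrow> 'a \<Rightarrow> real"
  assumes fin: "finite J" and indep: "indep_vars (\<lambda>_. borel) W J"
    and bounded: "\<And>j \<omega>. j \<in> J \<Longrightarrow> \<bar>W j \<omega>\<bar> \<le> 1"
    and mean: "\<And>j. j \<in> J \<Longrightarrow> expectation (W j) = 0"
    and var: "(\<Sum>j\<in>J. expectation (\<lambda>\<omega>. (W j \<omega>)\<^sup>2)) \<le> v" and "0 < v" "0 \<le> q"
  shows "prob {\<omega> \<in> space M. q \<le> (\<Sum>j\<in>J. W j \<omega>)} \<le> exp 1 * v powr q"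
proof (cases "v \<le> 1")
  case False
  \<comment> \<open>Here \<open>ln (1 / v)\<close> would be negative, but the bound exceeds 1.\<close>
  have "prob {\<omega> \<in> space M. q \<le> (\<Sum>j\<in>J. W j \<omega>)} \<le> 1" by (rule prob_le_1)
  also have "1 \<le> exp 1 * v powr q"
    using False \<open>0 \<le> q\<close> mult_mono[of 1 "exp 1" 1 "v powr q"] by (simp add: ge_one_powr_ge_zero)
  finally show ?thesis .
next
  case True
  define s where "s = ln (1 / v)"
  have s: "0 \<le> s" "exp s = 1 / v" using True \<open>0 < v\<close> by (auto simp: s_def)
  have W[measurable]: "W j \<in> borel_measurable M" if "j \<in> J" for j
    using indep that by (auto simp: indep_vars_def)
  have S[measurable]: "(\<lambda>\<omega>. \<Sum>j\<in>J. W j \<omega>) \<in> borel_measurable M" by measurable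
  have "(\<integral>\<^sup>+\<omega>. ennreal (exp (s * (\<Sum>j\<in>J. W j \<omega>))) \<partial>M)
      = (\<integral>\<^sup>+\<omega>. (\<Prod>j\<in>J. ennreal (exp (s * W j \<omega>))) \<partial>M)"
    by (simp add: sum_distrib_left exp_sum[OF fin] prod_ennreal)
  also have "\<dots> = (\<Prod>j\<in>J. \<integral>\<^sup>+\<omega>. ennreal (exp (s * W j \<omega>)) \<partial>M)"
    by (intro indep_vars_nn_integral fin indep_vars_compose2[OF indep]) auto
  also have "\<dots> \<le> (\<Prod>j\<in>J. ennreal (exp (expectation (\<lambda>\<omega>. (W j \<omega>)\<^sup>2) * exp s)))"
    by (intro prod_mono_ennreal exp_moment_bounded_centred W bounded mean s)
  also have "\<dots> = ennreal (exp ((\<Sum>j\<in>J. expectation (\<lambda>\<omega>. (W j \<omega>)\<^sup>2)) * exp s))"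
    by (simp add: prod_ennreal exp_sum[OF fin] sum_distrib_right)
  also have "\<dots> \<le> ennreal (exp 1)"
    using var \<open>0 < v\<close> by (intro ennreal_leI) (simp add: s field_simps)
  finally have mgf: "(\<integral>\<^sup>+\<omega>. ennreal (exp (s * (\<Sum>j\<in>J. W j \<omega>))) \<partial>M) \<le> ennreal (exp 1)" .
  have "ennreal (prob {\<omega> \<in> space M. q \<le> (\<Sum>j\<in>J. W j \<omega>)})
      = (\<integral>\<^sup>+\<omega>. indicator {\<omega> \<in> space M. q \<le> (\<Sum>j\<in>J. W j \<omega>)} \<omega> \<partial>M)"
    by (simp add: emeasure_eq_measure)
  also have "\<dots> \<le> (\<integral>\<^sup>+\<omega>. ennreal (exp (- (s * q))) * ennreal (exp (s * (\<Sum>j\<in>J. W j \<omega>))) \<partial>M)"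
  proof (intro nn_integral_mono)
    fix \<omega>
    have "1 \<le> exp (s * ((\<Sum>j\<in>J. W j \<omega>) - q))" if "q \<le> (\<Sum>j\<in>J. W j \<omega>)"
      using that s by simp
    then show "indicator {\<omega> \<in> space M. q \<le> (\<Sum>j\<in>J. W j \<omega>)} \<omega>
        \<le> ennreal (exp (- (s * q))) * ennreal (exp (s * (\<Sum>j\<in>J. W j \<omega>)))"
      by (auto simp: indicator_def ennreal_mult'[symmetric] exp_add[symmetric] algebra_simps)
  qed
  also have "\<dots> = ennreal (exp (- (s * q))) * (\<integral>\<^sup>+\<omega>. ennreal (exp (s * (\<Sum>j\<in>J. W j \<omega>))) \<partial>M)"
    by (rule nn_integral_cmult) measurable
  also have "\<dots> \<le> ennreal (exp (- (s * q))) * ennreal (exp 1)"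
    by (rule mult_left_mono[OF mgf]) simp
  also have "\<dots> = ennreal (exp 1 * v powr q)"
    using \<open>0 < v\<close> by (simp add: ennreal_mult'[symmetric] powr_def s_def ln_div mult.commute)
  finally show ?thesis by simp
qed

lemma (in prob_space) bennett:
  fixes W :: "'i \<Rightarrow> 'a \<Rightarrow> real"
  assumes fin: "finite J" and indep: "indep_vars (\<lambda>_. borel) W J"
    and bounded: "\<And>j \<omega>. j \<in> J \<Longrightarrow> \<bar>W j \<omega>\<bar> \<le> 1"
    and mean: "\<And>j. j \<in> J \<Longrightarrow> expectation (W j) = 0"
    and var: "(\<Sum>j\<in>J. expectation (\<lambda>\<omega>. (W j \<omega>)\<^sup>2)) \<le> v" and "0 < v" "0 \<le> q"
  shows "prob {\<omega> \<in> space M. q \<le> \<bar>\<Sum>j\<in>J. W j \<omega>\<bar>} \<le> 2 * exp 1 * v powr q"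
proof -
  have W[measurable]: "W j \<in> borel_measurable M" if "j \<in> J" for j
    using indep that by (auto simp: indep_vars_def)
  have neg: "prob {\<omega> \<in> space M. q \<le> (\<Sum>j\<in>J. - W j \<omega>)} \<le> exp 1 * v powr q"
    by (rule bennett_one_sided[OF fin indep_vars_compose2[OF indep]])
       (use assms in \<open>auto simp: integral_minus\<close>)
  have "prob {\<omega> \<in> space M. q \<le> \<bar>\<Sum>j\<in>J. W j \<omega>\<bar>}
      \<le> prob ({\<omega> \<in> space M. q \<le> (\<Sum>j\<in>J. W j \<omega>)} \<union> {\<omega> \<in> space M. q \<le> (\<Sum>j\<in>J. - W j \<omega>)})"
    by (intro finite_measure_mono) (auto simp: sum_negf abs_if split: if_splits)
  also have "\<dots> \<le> prob {\<omega> \<in> space M. q \<le> (\<Sum>j\<in>J. W j \<omega>)} + prob {\<omega> \<in> space M. q \<le> (\<Sum>j\<in>J. - W j \<omega>)}"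
    by (rule measure_Un_le) measurable
  also have "\<dots> \<le> 2 * exp 1 * v powr q"
    using bennett_one_sided[OF assms] neg by simp
  finally show ?thesis .
qed

section \<open>Maxima of linear combinations of independent stable variables\<close>

lemma (in prob_space) stable_truncation_second_moment:
  assumes Z[measurable]: "Z \<in> borel_measurable M"
    and char: "\<And>\<theta>. char (distr M borel Z) \<theta> = of_real (exp (- (\<bar>\<theta>\<bar> powr \<alpha> * w)))"
    and "0 < \<alpha>" "0 \<le> w" "0 < a"
  shows "expectation (\<lambda>\<omega>. (if \<bar>Z \<omega>\<bar> \<le> a then Z \<omega> else 0)\<^sup>2) \<le> 8 * w * a powr (2 - \<alpha>)"
proof -
  have le: "(if \<bar>Z \<omega>\<bar> \<le> a then Z \<omega> else 0)\<^sup>2 \<le> a\<^sup>2 * min 1 ((1 / a * Z \<omega>)\<^sup>2)" for \<omega>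
  proof (cases "\<bar>Z \<omega>\<bar> \<le> a")
    case True
    then have "(Z \<omega>)\<^sup>2 \<le> a\<^sup>2" using abs_le_square_iff[of "Z \<omega>" a] \<open>0 < a\<close> by simp
    then show ?thesis using True \<open>0 < a\<close> by (simp add: min_def power_divide field_simps)
  qed auto
  have "expectation (\<lambda>\<omega>. (if \<bar>Z \<omega>\<bar> \<le> a then Z \<omega> else 0)\<^sup>2)
      \<le> expectation (\<lambda>\<omega>. a\<^sup>2 * min 1 ((1 / a * Z \<omega>)\<^sup>2))"
  proof (intro integral_mono integrable_const_bound[where B = "a\<^sup>2"] AE_I2 le)
    fix \<omega>
    show "norm ((if \<bar>Z \<omega>\<bar> \<le> a then Z \<omega> else 0)\<^sup>2) \<le> a\<^sup>2"
      using abs_le_square_iff[of "Z \<omega>" a] \<open>0 < a\<close> by simp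
    show "norm (a\<^sup>2 * min 1 ((1 / a * Z \<omega>)\<^sup>2)) \<le> a\<^sup>2"
      using mult_left_mono[of "min 1 ((1 / a * Z \<omega>)\<^sup>2)" 1 "a\<^sup>2"] by simp
  qed measurable
  also have "\<dots> = a\<^sup>2 * expectation (\<lambda>\<omega>. min 1 ((1 / a * Z \<omega>)\<^sup>2))"
    by (rule integral_mult_right_zero)
  also have "\<dots> \<le> a\<^sup>2 * (8 * w * \<bar>1 / a\<bar> powr \<alpha>)"
    by (intro mult_left_mono stable_truncated_moment[OF prob_space_axioms assms(1-4)]) simp
  also have "\<dots> = 8 * w * a powr (2 - \<alpha>)"
    using \<open>0 < a\<close> by (simp add: powr_diff powr_numeral powr_divide)
  finally show ?thesis .
qed

text \<open>The first summand bounds the probability of a jump too large for the truncation levels \<open>a j\<close>,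
  whatever the size of \<open>I\<close>. The second is a union bound over \<open>I\<close> for the truncated sums. The levels are
  chosen so that \<open>m j * a j = L / q\<close>: after rescaling by \<open>q / L\<close> the truncated summands \<open>W t j\<close>
  are bounded by 1 and the level \<open>L\<close> becomes \<open>q\<close>.\<close>

lemma (in prob_space) stable_vector_max_tail:
  fixes Z :: "'j \<Rightarrow> 'a \<Rightarrow> real" and x :: "'i \<Rightarrow> 'j \<Rightarrow> real"
  assumes fin: "finite J" "finite I" and indep: "indep_vars (\<lambda>_. borel) Z J"
    and char: "\<And>j \<theta>. j \<in> J \<Longrightarrow>
      char (distr M borel (Z j)) \<theta> = of_real (exp (- (\<bar>\<theta>\<bar> powr \<alpha> * w j)))"
    and \<alpha>: "0 < \<alpha>" "\<alpha> < 2" and w: "\<And>j. j \<in> J \<Longrightarrow> 0 \<le> w j"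
    and m: "\<And>j. j \<in> J \<Longrightarrow> 0 < m j" and x: "\<And>t j. t \<in> I \<Longrightarrow> j \<in> J \<Longrightarrow> \<bar>x t j\<bar> \<le> m j"
    and D: "\<And>t. t \<in> I \<Longrightarrow> (\<Sum>j\<in>J. \<bar>x t j\<bar> powr \<alpha> * w j) \<le> D"
    and pos: "0 < D" "0 < q" "0 < L"
  shows "prob {\<omega> \<in> space M. \<exists>t\<in>I. L < \<bar>\<Sum>j\<in>J. x t j * Z j \<omega>\<bar>}
    \<le> 8 * (\<Sum>j\<in>J. m j powr \<alpha> * w j) * (q / L) powr \<alpha>
       + card I * (2 * exp 1 * (8 * D * (q / L) powr \<alpha>) powr q)"
proof -
  define a where "a j = L / (q * m j)" for j
  define T where "T j \<omega> = (if \<bar>Z j \<omega>\<bar> \<le> a j then Z j \<omega> else 0)" for j \<omega>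
  define W where "W t j \<omega> = x t j * (q / L) * T j \<omega>" for t j \<omega>
  define v where "v = 8 * D * (q / L) powr \<alpha>"
  have a: "0 < a j" if "j \<in> J" for j using m[OF that] pos by (simp add: a_def)
  have Z[measurable]: "Z j \<in> borel_measurable M" if "j \<in> J" for j
    using indep that by (auto simp: indep_vars_def)
  have v: "0 < v" using pos by (simp add: v_def)
  have large: "prob (\<Union>j\<in>J. {\<omega> \<in> space M. a j < \<bar>Z j \<omega>\<bar>}) \<le> 8 * (\<Sum>j\<in>J. m j powr \<alpha> * w j) * (q / L) powr \<alpha>"
  proof -
    have "prob (\<Union>j\<in>J. {\<omega> \<in> space M. a j < \<bar>Z j \<omega>\<bar>}) \<le> (\<Sum>j\<in>J. prob {\<omega> \<in> space M. a j < \<bar>Z j \<omega>\<bar>})"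
      by (intro finite_measure_subadditive_finite fin) auto
    also have "\<dots> \<le> (\<Sum>j\<in>J. 8 * w j * a j powr (- \<alpha>))"
      by (intro sum_mono stable_tail[OF prob_space_axioms Z char] a w \<alpha>)
    also have "\<dots> = (\<Sum>j\<in>J. 8 * (m j powr \<alpha> * w j) * (q / L) powr \<alpha>)"
    proof (intro sum.cong refl)
      fix j assume j: "j \<in> J"
      have "a j powr (- \<alpha>) = (m j * (q / L)) powr \<alpha>"
        using m[OF j] pos by (simp add: a_def powr_minus inverse_powr[symmetric] mult.commute)
      also have "\<dots> = m j powr \<alpha> * (q / L) powr \<alpha>"
        by (rule powr_mult)
      finally show "8 * w j * a j powr (- \<alpha>) = 8 * (m j powr \<alpha> * w j) * (q / L) powr \<alpha>"
        by simp
    qed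
    also have "\<dots> = 8 * (\<Sum>j\<in>J. m j powr \<alpha> * w j) * (q / L) powr \<alpha>"
      by (simp add: sum_distrib_left sum_distrib_right mult.assoc)
    finally show ?thesis .
  qed
  have small: "prob {\<omega> \<in> space M. q \<le> \<bar>\<Sum>j\<in>J. W t j \<omega>\<bar>} \<le> 2 * exp 1 * v powr q" if t: "t \<in> I" for t
  proof (rule bennett[OF fin(1)])
    let ?g = "\<lambda>j z. x t j * (q / L) * (if \<bar>z\<bar> \<le> a j then z else 0)"
    have "indep_vars (\<lambda>_. borel) (\<lambda>j \<omega>. ?g j (Z j \<omega>)) J"
      by (rule indep_vars_compose2[OF indep]) measurable
    then show "indep_vars (\<lambda>_. borel) (W t) J"
      by (simp add: W_def[abs_def] T_def)
    show "\<bar>W t j \<omega>\<bar> \<le> 1" if j: "j \<in> J" for j \<omega>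
    proof -
      have "\<bar>W t j \<omega>\<bar> = \<bar>x t j\<bar> * (q / L) * \<bar>T j \<omega>\<bar>"
        using pos by (simp add: W_def abs_mult)
      also have "\<dots> \<le> m j * (q / L) * a j"
        using pos x[OF t j] m[OF j] a[OF j] by (intro mult_mono) (auto simp: T_def)
      also have "\<dots> = 1" using pos m[OF j] by (simp add: a_def)
      finally show ?thesis .
    qed
    show "expectation (W t j) = 0" if j: "j \<in> J" for j
      using stable_truncated_mean[OF prob_space_axioms Z[OF j] char[OF j], of "a j"]
      by (simp add: W_def[abs_def] T_def)
    have "(\<Sum>j\<in>J. expectation (\<lambda>\<omega>. (W t j \<omega>)\<^sup>2)) \<le> (\<Sum>j\<in>J. 8 * (\<bar>x t j\<bar> powr \<alpha> * w j) * (q / L) powr \<alpha>)"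
    proof (rule sum_mono)
      fix j assume j: "j \<in> J"
      have "expectation (\<lambda>\<omega>. (W t j \<omega>)\<^sup>2) = (x t j * (q / L))\<^sup>2 * expectation (\<lambda>\<omega>. (T j \<omega>)\<^sup>2)"
        unfolding W_def power_mult_distrib by (rule integral_mult_right_zero)
      also have "\<dots> \<le> (x t j * (q / L))\<^sup>2 * (8 * w j * a j powr (2 - \<alpha>))"
        unfolding T_def
        by (intro mult_left_mono stable_truncation_second_moment Z j char \<alpha> w a) simp
      also have "\<dots> = 8 * w j * (m j powr \<alpha> * (\<bar>x t j\<bar> / m j) powr 2) * (q / L) powr \<alpha>"
      proof -
        have "a j powr (2 - \<alpha>) = (a j)\<^sup>2 * (m j * (q / L)) powr \<alpha>"
          using a[OF j] m[OF j] pos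
          by (simp add: powr_diff powr_numeral a_def powr_divide powr_mult field_simps)
        also have "\<dots> = (a j)\<^sup>2 * (m j powr \<alpha> * (q / L) powr \<alpha>)"
          by (simp only: powr_mult[of "m j" "q / L"])
        finally have "(x t j * (q / L))\<^sup>2 * (8 * w j * a j powr (2 - \<alpha>))
            = 8 * w j * (m j powr \<alpha> * (x t j * (q / L) * a j)\<^sup>2) * (q / L) powr \<alpha>"
          by (simp add: power_mult_distrib power_divide)
        moreover have "x t j * (q / L) * a j = x t j / m j"
          using m[OF j] pos by (simp add: a_def)
        moreover have "(x t j / m j)\<^sup>2 = (\<bar>x t j\<bar> / m j) powr 2"
          using m[OF j] by (simp add: powr_numeral power_divide)
        ultimately show ?thesis by (simp only:)
      qed
      \<comment> \<open>Lowering the exponent from 2 to \<open>\<alpha>\<close> removes \<open>m j\<close>, so that the variance is governed by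
        the scale at the single index \<open>t\<close> instead of that of the maximum.\<close>
      also have "\<dots> \<le> 8 * w j * (m j powr \<alpha> * (\<bar>x t j\<bar> / m j) powr \<alpha>) * (q / L) powr \<alpha>"
        using x[OF t j] m[OF j] w[OF j] \<alpha>
        by (intro mult_right_mono mult_left_mono powr_mono') auto
      also have "\<dots> = 8 * (\<bar>x t j\<bar> powr \<alpha> * w j) * (q / L) powr \<alpha>"
        using m[OF j] by (simp add: powr_divide)
      finally show "expectation (\<lambda>\<omega>. (W t j \<omega>)\<^sup>2) \<le> 8 * (\<bar>x t j\<bar> powr \<alpha> * w j) * (q / L) powr \<alpha>" .
    qed
    also have "\<dots> = 8 * (\<Sum>j\<in>J. \<bar>x t j\<bar> powr \<alpha> * w j) * (q / L) powr \<alpha>"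
      by (simp add: sum_distrib_left sum_distrib_right mult.assoc)
    also have "\<dots> \<le> v"
      unfolding v_def using D[OF t] by (intro mult_right_mono mult_left_mono) auto
    finally show "(\<Sum>j\<in>J. expectation (\<lambda>\<omega>. (W t j \<omega>)\<^sup>2)) \<le> v" .
  qed (use v pos in auto)
  have "prob {\<omega> \<in> space M. \<exists>t\<in>I. L < \<bar>\<Sum>j\<in>J. x t j * Z j \<omega>\<bar>}
      \<le> prob ((\<Union>j\<in>J. {\<omega> \<in> space M. a j < \<bar>Z j \<omega>\<bar>}) \<union> (\<Union>t\<in>I. {\<omega> \<in> space M. q \<le> \<bar>\<Sum>j\<in>J. W t j \<omega>\<bar>}))"
  proof (rule finite_measure_mono)
    show "{\<omega> \<in> space M. \<exists>t\<in>I. L < \<bar>\<Sum>j\<in>J. x t j * Z j \<omega>\<bar>}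
      \<subseteq> (\<Union>j\<in>J. {\<omega> \<in> space M. a j < \<bar>Z j \<omega>\<bar>}) \<union> (\<Union>t\<in>I. {\<omega> \<in> space M. q \<le> \<bar>\<Sum>j\<in>J. W t j \<omega>\<bar>})"
    proof (rule subsetI, rule UnCI)
      fix \<omega>
      assume "\<omega> \<in> {\<omega> \<in> space M. \<exists>t\<in>I. L < \<bar>\<Sum>j\<in>J. x t j * Z j \<omega>\<bar>}"
      then obtain t where \<omega>: "\<omega> \<in> space M" "t \<in> I" "L < \<bar>\<Sum>j\<in>J. x t j * Z j \<omega>\<bar>"
        by blast
      assume "\<omega> \<notin> (\<Union>t\<in>I. {\<omega> \<in> space M. q \<le> \<bar>\<Sum>j\<in>J. W t j \<omega>\<bar>})"
      then have small_sum: "\<bar>\<Sum>j\<in>J. W t j \<omega>\<bar> < q" using \<omega> by force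
      show "\<omega> \<in> (\<Union>j\<in>J. {\<omega> \<in> space M. a j < \<bar>Z j \<omega>\<bar>})"
      proof (rule ccontr)
        assume "\<not> ?thesis"
        then have "\<bar>Z j \<omega>\<bar> \<le> a j" if "j \<in> J" for j using that \<omega>(1) by force
        then have "(\<Sum>j\<in>J. W t j \<omega>) = q / L * (\<Sum>j\<in>J. x t j * Z j \<omega>)"
          by (simp add: W_def T_def sum_distrib_left mult_ac)
        then have "\<bar>\<Sum>j\<in>J. W t j \<omega>\<bar> = q / L * \<bar>\<Sum>j\<in>J. x t j * Z j \<omega>\<bar>"
          using pos by (simp add: abs_mult)
        moreover have "q \<le> q / L * \<bar>\<Sum>j\<in>J. x t j * Z j \<omega>\<bar>"
          using \<omega>(3) pos by (simp add: field_simps)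
        ultimately show False using small_sum by linarith
      qed
    qed
    show "(\<Union>j\<in>J. {\<omega> \<in> space M. a j < \<bar>Z j \<omega>\<bar>}) \<union> (\<Union>t\<in>I. {\<omega> \<in> space M. q \<le> \<bar>\<Sum>j\<in>J. W t j \<omega>\<bar>}) \<in> events"
      unfolding W_def T_def using fin by (intro sets.Un sets.finite_UN) measurable
  qed
  also have "\<dots> \<le> prob (\<Union>j\<in>J. {\<omega> \<in> space M. a j < \<bar>Z j \<omega>\<bar>})
      + prob (\<Union>t\<in>I. {\<omega> \<in> space M. q \<le> \<bar>\<Sum>j\<in>J. W t j \<omega>\<bar>})"
    unfolding W_def T_def using fin by (intro measure_Un_le sets.finite_UN) measurable
  also have "prob (\<Union>t\<in>I. {\<omega> \<in> space M. q \<le> \<bar>\<Sum>j\<in>J. W t j \<omega>\<bar>})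
      \<le> (\<Sum>t\<in>I. prob {\<omega> \<in> space M. q \<le> \<bar>\<Sum>j\<in>J. W t j \<omega>\<bar>})"
    unfolding W_def T_def by (intro finite_measure_subadditive_finite fin) auto
  also have "\<dots> \<le> (\<Sum>t\<in>I. 2 * exp 1 * v powr q)"
    by (intro sum_mono small)
  finally show ?thesis using large by (simp add: v_def)
qed

section \<open>Integrals of simple functions\<close>

lemma sas_random_measure_finite_additive:
  fixes A :: "nat \<Rightarrow> 's set"
  assumes M: "sas_random_measure \<alpha> \<mu> Q M"
    and J: "finite J" and A: "A ` J \<subseteq> fmeasurable \<mu>" "disjoint_family_on A J"
  shows "AE \<omega> in Q. M (\<Union>j\<in>J. A j) \<omega> = (\<Sum>j\<in>J. M (A j) \<omega>)"
proof -
  have additive: "AE \<omega> in Q. (\<lambda>i. M (B i) \<omega>) sums M (\<Union>i. B i) \<omega>"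
    if "range B \<subseteq> fmeasurable \<mu>" "disjoint_family B" "(\<Union>i. B i) \<in> fmeasurable \<mu>" for B :: "nat \<Rightarrow> 's set"
    using M that unfolding sas_random_measure_def by blast
  have null: "AE \<omega> in Q. M {} \<omega> = 0"
  proof -
    have "AE \<omega> in Q. (\<lambda>i::nat. M {} \<omega>) sums M {} \<omega>"
      using additive[of "\<lambda>_. {}"] by (simp add: disjoint_family_on_def)
    then show ?thesis
      by eventually_elim (metis sums_summable summable_const_iff)
  qed
  \<comment> \<open>Finite additivity is countable additivity for a family padded with empty sets.\<close>
  define B where "B i = (if i \<in> J then A i else {})" for i
  have UB: "(\<Union>i. B i) = (\<Union>j\<in>J. A j)" by (auto simp: B_def split: if_splits)
  have "AE \<omega> in Q. (\<lambda>i. M (B i) \<omega>) sums M (\<Union>i. B i) \<omega>"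
  proof (rule additive)
    show "range B \<subseteq> fmeasurable \<mu>" using A(1) by (auto simp: B_def)
    show "disjoint_family B" using A(2) by (auto simp: B_def disjoint_family_on_def)
    show "(\<Union>i. B i) \<in> fmeasurable \<mu>"
      unfolding UB using J A(1) by (intro fmeasurable.finite_UN) auto
  qed
  with null show ?thesis
  proof eventually_elim
    case (elim \<omega>)
    have "(\<lambda>i. M (B i) \<omega>) sums (\<Sum>j\<in>J. M (B j) \<omega>)"
      by (rule sums_finite[OF J]) (simp add: B_def elim(1))
    moreover have "(\<Sum>j\<in>J. M (B j) \<omega>) = (\<Sum>j\<in>J. M (A j) \<omega>)"
      by (simp add: B_def)
    ultimately show ?case
      using elim(2) by (metis UB sums_unique2)
  qed
qed

text \<open>The level sets of the vector-valued map \<open>s \<mapsto> (h t s)\<^sub>t\<close>, apart from the one at the zero vector,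
  are disjoint and of finite measure, and each \<open>h t\<close> is constant on them. Independent scattering then
  turns the integrals of all \<open>h t\<close> into linear combinations of the same independent variables. The
  identity holds only almost surely because the random measure is additive only almost surely.\<close>

lemma simple_functions_common_partition:
  fixes h :: "'i \<Rightarrow> 's \<Rightarrow> real"
  assumes M: "sas_random_measure \<alpha> \<mu> Q M" and I: "finite I"
    and simple: "\<And>t. t \<in> I \<Longrightarrow> simple_function \<mu> (h t)"
    and supp: "\<And>t. t \<in> I \<Longrightarrow> {s \<in> space \<mu>. h t s \<noteq> 0} \<in> fmeasurable \<mu>"
  obtains k and A :: "nat \<Rightarrow> 's set" and x :: "'i \<Rightarrow> nat \<Rightarrow> real"
  where "A ` {..<k} \<subseteq> fmeasurable \<mu>" "disjoint_family_on A {..<k}"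
    and "\<And>t j s. t \<in> I \<Longrightarrow> j < k \<Longrightarrow> s \<in> A j \<Longrightarrow> h t s = x t j"
    and "\<And>j. j < k \<Longrightarrow> \<exists>t\<in>I. x t j \<noteq> 0"
    and "\<And>t. t \<in> I \<Longrightarrow>
      AE \<omega> in Q. simple_stable_integral \<mu> M (h t) \<omega> = (\<Sum>j<k. x t j * M (A j) \<omega>)"
proof -
  define H where "H s = (\<lambda>t\<in>I. h t s)" for s
  define V where "V = H ` space \<mu> - {\<lambda>t\<in>I. 0}"
  have "finite (H ` space \<mu>)"
  proof (rule finite_subset)
    show "H ` space \<mu> \<subseteq> (\<Pi>\<^sub>E t\<in>I. h t ` space \<mu>)" by (auto simp: H_def)
    show "finite (\<Pi>\<^sub>E t\<in>I. h t ` space \<mu>)"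
      using simple by (intro finite_PiE I) (auto dest: simple_functionD(1))
  qed
  then have V: "finite V" by (simp add: V_def)
  obtain e where e: "bij_betw e {..<card V} V"
    using ex_bij_betw_nat_finite[OF V] by (auto simp: atLeast0LessThan)
  define k where "k = card V"
  define A where "A j = {s \<in> space \<mu>. H s = e j}" for j
  define x where "x t j = e j t" for t j
  have eV: "e j \<in> V" if "j < k" for j
    using e that by (auto simp: k_def bij_betw_def)
  have val: "h t s = x t j" if "t \<in> I" "s \<in> A j" for t j s
    using that by (auto simp: A_def x_def H_def fun_eq_iff restrict_def split: if_splits)
  have nz: "\<exists>t\<in>I. x t j \<noteq> 0" if "j < k" for j
  proof (rule ccontr)
    assume "\<not> ?thesis"
    then have z: "e j t = 0" if "t \<in> I" for t using that by (auto simp: x_def)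
    from eV[OF that] obtain s where "e j = H s" by (auto simp: V_def)
    then have "e j = (\<lambda>t\<in>I. 0)" using z by (auto simp: H_def fun_eq_iff)
    with eV[OF that] show False by (simp add: V_def)
  qed
  have Afm: "A j \<in> fmeasurable \<mu>" if j: "j < k" for j
  proof -
    obtain t where t: "t \<in> I" "x t j \<noteq> 0" using nz[OF j] by blast
    have ext: "e j \<in> extensional I" using eV[OF j] by (auto simp: V_def H_def)
    have "A j = {s \<in> space \<mu>. \<forall>t\<in>I. h t s = e j t}"
      using ext by (auto simp: A_def H_def fun_eq_iff extensional_def)
    also have "\<dots> \<in> sets \<mu>"
    proof (intro sets.sets_Collect_finite_All' I)
      fix t assume "t \<in> I"
      then have [measurable]: "h t \<in> borel_measurable \<mu>" by (intro borel_measurable_simple_function simple)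
      show "{s \<in> space \<mu>. h t s = e j t} \<in> sets \<mu>" by measurable
    qed (use t in auto)
    finally have "A j \<in> sets \<mu>" .
    moreover have "A j \<subseteq> {s \<in> space \<mu>. h t s \<noteq> 0}"
      using val[OF t(1)] t(2) by (auto simp: A_def)
    ultimately show ?thesis using fmeasurableI2[OF supp[OF t(1)]] by blast
  qed
  have disj: "disjoint_family_on A {..<k}"
    using e by (fastforce simp: disjoint_family_on_def A_def k_def bij_betw_def inj_on_def)
  have int: "AE \<omega> in Q. simple_stable_integral \<mu> M (h t) \<omega> = (\<Sum>j<k. x t j * M (A j) \<omega>)"
    if t: "t \<in> I" for t
  proof -
    let ?Y = "h t ` space \<mu> - {0}"
    let ?J = "\<lambda>y. {j. j < k \<and> x t j = y}"
    have Y: "finite ?Y" using simple_functionD(1)[OF simple[OF t]] by simp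
    have level: "{s \<in> space \<mu>. h t s = y} = (\<Union>j\<in>?J y. A j)" if "y \<in> ?Y" for y
    proof (intro equalityI subsetI)
      fix s assume s: "s \<in> {s \<in> space \<mu>. h t s = y}"
      then have "H s t \<noteq> 0" using that t by (auto simp: H_def)
      then have "H s \<in> V" using s t by (auto simp: V_def fun_eq_iff)
      then obtain j where j: "j < k" "e j = H s" using e by (force simp: bij_betw_def k_def image_iff)
      then have "s \<in> A j" using s by (simp add: A_def)
      moreover have "x t j = y" using val[OF t \<open>s \<in> A j\<close>] s by simp
      ultimately show "s \<in> (\<Union>j\<in>?J y. A j)" using j by auto
    next
      fix s assume "s \<in> (\<Union>j\<in>?J y. A j)"
      then show "s \<in> {s \<in> space \<mu>. h t s = y}" using val[OF t] by (auto simp: A_def)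
    qed
    have "AE \<omega> in Q. \<forall>y\<in>?Y. M (\<Union>j\<in>?J y. A j) \<omega> = (\<Sum>j\<in>?J y. M (A j) \<omega>)"
    proof (intro AE_finite_allI Y sas_random_measure_finite_additive[OF M])
      fix y
      show "A ` ?J y \<subseteq> fmeasurable \<mu>" using Afm by auto
      show "disjoint_family_on A (?J y)"
        by (rule disjoint_family_on_mono[OF _ disj]) auto
    qed auto
    then show ?thesis
    proof eventually_elim
      case (elim \<omega>)
      have "simple_stable_integral \<mu> M (h t) \<omega> = (\<Sum>y\<in>?Y. y * (\<Sum>j\<in>?J y. M (A j) \<omega>))"
        unfolding simple_stable_integral_def using elim level by (intro sum.cong) auto
      also have "\<dots> = (\<Sum>y\<in>?Y. \<Sum>j\<in>{j. j \<in> {j \<in> {..<k}. x t j \<noteq> 0} \<and> x t j = y}. x t j * M (A j) \<omega>)"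
        by (intro sum.cong) (auto simp: sum_distrib_left intro!: sum.cong)
      also have "\<dots> = (\<Sum>j\<in>{j \<in> {..<k}. x t j \<noteq> 0}. x t j * M (A j) \<omega>)"
      proof (rule sum.group)
        show "x t ` {j \<in> {..<k}. x t j \<noteq> 0} \<subseteq> ?Y"
        proof safe
          fix j assume j: "j < k" "x t j \<noteq> 0"
          then obtain s where "s \<in> space \<mu>" "e j = H s" using eV[OF j(1)] by (auto simp: V_def)
          then show "x t j \<in> h t ` space \<mu>" using t by (auto simp: x_def H_def)
        qed
      qed (use Y in auto)
      also have "\<dots> = (\<Sum>j<k. x t j * M (A j) \<omega>)"
        by (rule sum.mono_neutral_left) auto
      finally show ?case .
    qed
  qed
  show ?thesis
    by (rule that[of A k x]) (use Afm disj val nz int in auto)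
qed

lemma sum_disjoint_sets_le_nn_integral:
  fixes y :: "nat \<Rightarrow> real" and G :: "'s \<Rightarrow> ennreal"
  assumes A: "A ` {..<k} \<subseteq> fmeasurable \<mu>" "disjoint_family_on A {..<k}"
    and y: "\<And>j. j < k \<Longrightarrow> 0 \<le> y j" and le: "\<And>j s. j < k \<Longrightarrow> s \<in> A j \<Longrightarrow> ennreal (y j) \<le> G s"
  shows "ennreal (\<Sum>j<k. y j * measure \<mu> (A j)) \<le> (\<integral>\<^sup>+ s. G s \<partial>\<mu>)"
proof -
  have fm: "A j \<in> fmeasurable \<mu>" if "j < k" for j using A(1) that by auto
  have "ennreal (\<Sum>j<k. y j * measure \<mu> (A j)) = (\<Sum>j<k. ennreal (y j) * emeasure \<mu> (A j))"
    using y fm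
    by (subst sum_ennreal[symmetric]) (auto simp: ennreal_mult' emeasure_eq_measure2 intro!: sum.cong)
  also have "\<dots> = (\<Sum>j<k. \<integral>\<^sup>+ s. ennreal (y j) * indicator (A j) s \<partial>\<mu>)"
    using fm by (intro sum.cong refl nn_integral_cmult_indicator[symmetric]) auto
  also have "\<dots> = (\<integral>\<^sup>+ s. (\<Sum>j<k. ennreal (y j) * indicator (A j) s) \<partial>\<mu>)"
    using fm by (intro nn_integral_sum[symmetric]) auto
  also have "\<dots> \<le> (\<integral>\<^sup>+ s. G s \<partial>\<mu>)"
  proof (rule nn_integral_mono)
    fix s
    show "(\<Sum>j<k. ennreal (y j) * indicator (A j) s) \<le> G s"
    proof (cases "\<exists>j<k. s \<in> A j")
      case True
      then obtain j where j: "j < k" "s \<in> A j" by blast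
      have "(\<Sum>i<k. ennreal (y i) * indicator (A i) s) = ennreal (y j) * indicator (A j) s + (\<Sum>i\<in>{..<k} - {j}. ennreal (y i) * indicator (A i) s)"
        using j by (intro sum.remove) auto
      also have "(\<Sum>i\<in>{..<k} - {j}. ennreal (y i) * indicator (A i) s) = 0"
        using A(2) j by (intro sum.neutral) (auto simp: disjoint_family_on_def indicator_def)
      finally show ?thesis using le[OF j] j by simp
    qed (auto simp: indicator_def)
  qed
  finally show ?thesis .
qed

section \<open>Maxima of stable integrals\<close>

lemma simple_stable_integral_measurable:
  assumes M: "sas_random_measure \<alpha> \<mu> Q M" and simple: "simple_function \<mu> h"
    and supp: "{s \<in> space \<mu>. h s \<noteq> 0} \<in> fmeasurable \<mu>"
  shows "simple_stable_integral \<mu> M h \<in> borel_measurable Q"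
proof -
  have [measurable]: "h \<in> borel_measurable \<mu>" by (rule borel_measurable_simple_function[OF simple])
  have "M {s \<in> space \<mu>. h s = y} \<in> borel_measurable Q" if "y \<noteq> 0" for y
  proof -
    have "{s \<in> space \<mu>. h s = y} \<in> fmeasurable \<mu>"
      by (rule fmeasurableI2[OF supp]) (use that in auto)
    then show ?thesis using M unfolding sas_random_measure_def by blast
  qed
  then show ?thesis
    unfolding simple_stable_integral_def[abs_def] by (intro borel_measurable_sum borel_measurable_times) auto
qed

text \<open>The function \<open>G\<close> stands for the maximum of the functions \<open>\<bar>h t\<bar> powr \<alpha>\<close>. Allowing any dominating
  function lets the approximation error be absorbed later.\<close>

lemma simple_stable_integral_max_tail:
  fixes h :: "'i \<Rightarrow> 's \<Rightarrow> real" and G :: "'s \<Rightarrow> ennreal"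
  assumes \<alpha>: "0 < \<alpha>" "\<alpha> < 2" and Q: "prob_space Q"
    and M: "sas_random_measure \<alpha> \<mu> Q M" and I: "finite I"
    and simple: "\<And>t. t \<in> I \<Longrightarrow> simple_function \<mu> (h t)"
    and supp: "\<And>t. t \<in> I \<Longrightarrow> {s \<in> space \<mu>. h t s \<noteq> 0} \<in> fmeasurable \<mu>"
    and G: "\<And>t s. t \<in> I \<Longrightarrow> s \<in> space \<mu> \<Longrightarrow> ennreal (\<bar>h t s\<bar> powr \<alpha>) \<le> G s"
    and B: "(\<integral>\<^sup>+ s. G s \<partial>\<mu>) \<le> ennreal B" "0 \<le> B"
    and D: "\<And>t. t \<in> I \<Longrightarrow> (\<integral>\<^sup>+ s. ennreal (\<bar>h t s\<bar> powr \<alpha>) \<partial>\<mu>) \<le> ennreal D"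
    and pos: "0 < D" "0 < q" "0 < L"
  shows "measure Q {\<omega> \<in> space Q. \<exists>t\<in>I. L < \<bar>simple_stable_integral \<mu> M (h t) \<omega>\<bar>}
    \<le> 8 * B * (q / L) powr \<alpha> + card I * (2 * exp 1 * (8 * D * (q / L) powr \<alpha>) powr q)"
proof -
  interpret prob_space Q by fact
  show ?thesis
  proof (rule simple_functions_common_partition[of \<alpha> \<mu> Q M I h, OF M I simple supp]; (assumption)?)
    fix k and A :: "nat \<Rightarrow> 's set" and x :: "'i \<Rightarrow> nat \<Rightarrow> real"
    assume A: "A ` {..<k} \<subseteq> fmeasurable \<mu>" "disjoint_family_on A {..<k}"
      and val: "\<And>t j s. t \<in> I \<Longrightarrow> j < k \<Longrightarrow> s \<in> A j \<Longrightarrow> h t s = x t j"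
      and nz: "\<And>j. j < k \<Longrightarrow> \<exists>t\<in>I. x t j \<noteq> 0"
      and int: "\<And>t. t \<in> I \<Longrightarrow>
        AE \<omega> in Q. simple_stable_integral \<mu> M (h t) \<omega> = (\<Sum>j<k. x t j * M (A j) \<omega>)"
    have Afm: "A j \<in> fmeasurable \<mu>" if "j < k" for j using A(1) that by auto
    have Asp: "s \<in> space \<mu>" if "j < k" "s \<in> A j" for j s
      using Afm[OF that(1)] that(2) sets.sets_into_space[of "A j" \<mu>] by auto
    define m where "m j = Max ((\<lambda>t. \<bar>x t j\<bar>) ` I)" for j
    have x_le: "\<bar>x t j\<bar> \<le> m j" if "t \<in> I" for t j
      unfolding m_def using that I by auto
    have m_pos: "0 < m j" if j: "j < k" for j
    proof -
      obtain t where "t \<in> I" "x t j \<noteq> 0" using nz[OF j] by blast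
      then show ?thesis using x_le[of t j] by simp
    qed
    have sum_m: "(\<Sum>j<k. m j powr \<alpha> * measure \<mu> (A j)) \<le> B"
    proof -
      have "ennreal (\<Sum>j<k. m j powr \<alpha> * measure \<mu> (A j)) \<le> (\<integral>\<^sup>+ s. G s \<partial>\<mu>)"
      proof (rule sum_disjoint_sets_le_nn_integral[OF A])
        fix j s assume j: "j < k" "s \<in> A j"
        have "m j \<in> (\<lambda>t. \<bar>x t j\<bar>) ` I"
          unfolding m_def using I nz[OF j(1)] by (intro Max_in) auto
        then obtain t where t: "t \<in> I" "m j = \<bar>x t j\<bar>" by blast
        then show "ennreal (m j powr \<alpha>) \<le> G s"
          using G[OF t(1) Asp[OF j]] val[OF t(1) j] by simp
      qed simp
      also note B(1)
      finally show ?thesis using B(2) by simp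
    qed
    have sum_x: "(\<Sum>j<k. \<bar>x t j\<bar> powr \<alpha> * measure \<mu> (A j)) \<le> D" if t: "t \<in> I" for t
    proof -
      have "ennreal (\<Sum>j<k. \<bar>x t j\<bar> powr \<alpha> * measure \<mu> (A j)) \<le> (\<integral>\<^sup>+ s. ennreal (\<bar>h t s\<bar> powr \<alpha>) \<partial>\<mu>)"
        by (rule sum_disjoint_sets_le_nn_integral[OF A]) (use val[OF t] in auto)
      also note D[OF t]
      finally show ?thesis using pos by simp
    qed
    have indep: "indep_vars (\<lambda>_. borel) (\<lambda>j. M (A j)) {..<k}"
      using M A unfolding sas_random_measure_def by blast
    have char: "char (distr Q borel (M (A j))) \<theta> = of_real (exp (- (\<bar>\<theta>\<bar> powr \<alpha> * measure \<mu> (A j))))"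
      if "j < k" for j \<theta>
      using M Afm[OF that] unfolding sas_random_measure_def by blast
    have MA[measurable]: "M (A j) \<in> borel_measurable Q" if "j < k" for j
      using M Afm[OF that] unfolding sas_random_measure_def by blast
    have "AE \<omega> in Q. \<forall>t\<in>I. simple_stable_integral \<mu> M (h t) \<omega> = (\<Sum>j<k. x t j * M (A j) \<omega>)"
      using int by (intro AE_finite_allI I)
    then have "AE \<omega> in Q. \<omega> \<in> {\<omega> \<in> space Q. \<exists>t\<in>I. L < \<bar>simple_stable_integral \<mu> M (h t) \<omega>\<bar>} \<longrightarrow>
        \<omega> \<in> {\<omega> \<in> space Q. \<exists>t\<in>I. L < \<bar>\<Sum>j<k. x t j * M (A j) \<omega>\<bar>}"
    proof eventually_elim
      case (elim \<omega>)
      then show ?case by clarsimp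
    qed
    then have "prob {\<omega> \<in> space Q. \<exists>t\<in>I. L < \<bar>simple_stable_integral \<mu> M (h t) \<omega>\<bar>}
        \<le> prob {\<omega> \<in> space Q. \<exists>t\<in>I. L < \<bar>\<Sum>j<k. x t j * M (A j) \<omega>\<bar>}"
      by (rule finite_measure_mono_AE) (intro sets.sets_Collect_finite_Ex I, measurable)
    also have "\<dots> \<le> 8 * (\<Sum>j<k. m j powr \<alpha> * measure \<mu> (A j)) * (q / L) powr \<alpha>
        + card I * (2 * exp 1 * (8 * D * (q / L) powr \<alpha>) powr q)"
      using stable_vector_max_tail[OF finite_lessThan I indep _ \<alpha>, where m = m and x = x and D = D
          and w = "\<lambda>j. measure \<mu> (A j)" and q = q and L = L] char m_pos x_le sum_x pos by simp
    also have "\<dots> \<le> 8 * B * (q / L) powr \<alpha> + card I * (2 * exp 1 * (8 * D * (q / L) powr \<alpha>) powr q)"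
      by (intro add_right_mono mult_right_mono mult_left_mono sum_m) auto
    finally show ?thesis .
  qed
qed

lemma abs_powr_le_add_diff:
  fixes a b :: real
  assumes "0 < \<alpha>"
  shows "\<bar>a\<bar> powr \<alpha> \<le> 2 powr \<alpha> * (\<bar>b\<bar> powr \<alpha> + \<bar>a - b\<bar> powr \<alpha>)"
proof -
  have "\<bar>a\<bar> \<le> \<bar>b\<bar> + \<bar>a - b\<bar>" by simp
  also have "\<dots> \<le> 2 * max \<bar>b\<bar> \<bar>a - b\<bar>" by (simp add: max_def)
  finally have "\<bar>a\<bar> powr \<alpha> \<le> (2 * max \<bar>b\<bar> \<bar>a - b\<bar>) powr \<alpha>"
    using assms by (intro powr_mono2) auto
  also have "\<dots> = 2 powr \<alpha> * max \<bar>b\<bar> \<bar>a - b\<bar> powr \<alpha>"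
    by (rule powr_mult)
  also have "\<dots> \<le> 2 powr \<alpha> * (\<bar>b\<bar> powr \<alpha> + \<bar>a - b\<bar> powr \<alpha>)"
    by (intro mult_left_mono) (auto simp: max_def)
  finally show ?thesis .
qed

text \<open>Simple functions close in \<open>L\<^sup>\<alpha>\<close> have nearly the same norms, and their integrals are close in
  probability. The price is the factor \<open>2 powr \<alpha>\<close>, the added 1, and half of the level \<open>L\<close>; these
  constants do not depend on the index set.\<close>

lemma stable_integral_max_tail:
  fixes g :: "'i \<Rightarrow> 's \<Rightarrow> real" and G :: "'s \<Rightarrow> ennreal"
  assumes \<alpha>: "0 < \<alpha>" "\<alpha> < 2" and Q: "prob_space Q"
    and M: "sas_random_measure \<alpha> \<mu> Q M" and I: "finite I"
    and X: "\<And>t. t \<in> I \<Longrightarrow> is_stable_integral \<alpha> \<mu> Q M (g t) (X t)"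
    and Gm[measurable]: "G \<in> borel_measurable \<mu>"
    and G: "\<And>t s. t \<in> I \<Longrightarrow> s \<in> space \<mu> \<Longrightarrow> ennreal (\<bar>g t s\<bar> powr \<alpha>) \<le> G s"
    and B: "(\<integral>\<^sup>+ s. G s \<partial>\<mu>) \<le> ennreal B" "0 \<le> B"
    and D: "\<And>t. t \<in> I \<Longrightarrow> (\<integral>\<^sup>+ s. ennreal (\<bar>g t s\<bar> powr \<alpha>) \<partial>\<mu>) \<le> ennreal D" "0 \<le> D"
    and pos: "0 < q" "0 < L"
  shows "measure Q {\<omega> \<in> space Q. \<exists>t\<in>I. L < \<bar>X t \<omega>\<bar>}
    \<le> 8 * (2 powr \<alpha> * (B + 1)) * (2 * q / L) powr \<alpha>
       + card I * (2 * exp 1 * (8 * (2 powr \<alpha> * (D + 1)) * (2 * q / L) powr \<alpha>) powr q)"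
    (is "_ \<le> ?bound")
proof (rule field_le_epsilon)
  fix \<eta> :: real assume \<eta>: "0 < \<eta>"
  interpret prob_space Q by fact
  have "\<forall>t\<in>I. \<exists>h :: nat \<Rightarrow> 's \<Rightarrow> real.
        (\<forall>k. simple_function \<mu> (h k) \<and> {s \<in> space \<mu>. h k s \<noteq> 0} \<in> fmeasurable \<mu>) \<and>
        (\<lambda>k. \<integral>\<^sup>+ s. ennreal (\<bar>h k s - g t s\<bar> powr \<alpha>) \<partial>\<mu>) \<longlonglongrightarrow> 0 \<and>
        converges_in_prob Q (\<lambda>k. simple_stable_integral \<mu> M (h k)) (X t)"
    using X unfolding is_stable_integral_def by simp
  from bchoice[OF this] obtain h where h_all: "\<forall>t\<in>I.
        (\<forall>k. simple_function \<mu> (h t k) \<and> {s \<in> space \<mu>. h t k s \<noteq> 0} \<in> fmeasurable \<mu>) \<and>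
        (\<lambda>k. \<integral>\<^sup>+ s. ennreal (\<bar>h t k s - g t s\<bar> powr \<alpha>) \<partial>\<mu>) \<longlonglongrightarrow> 0 \<and>
        converges_in_prob Q (\<lambda>k. simple_stable_integral \<mu> M (h t k)) (X t)" ..
  have h: "simple_function \<mu> (h t k)" "{s \<in> space \<mu>. h t k s \<noteq> 0} \<in> fmeasurable \<mu>"
    and Lalpha: "(\<lambda>k. \<integral>\<^sup>+ s. ennreal (\<bar>h t k s - g t s\<bar> powr \<alpha>) \<partial>\<mu>) \<longlonglongrightarrow> 0"
    and inprob: "converges_in_prob Q (\<lambda>k. simple_stable_integral \<mu> M (h t k)) (X t)"
    if "t \<in> I" for t k
    using bspec[OF h_all that] by simp_all
  let ?S = "\<lambda>t k. simple_stable_integral \<mu> M (h t k)"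
  have [measurable]: "g t \<in> borel_measurable \<mu>" "X t \<in> borel_measurable Q" if "t \<in> I" for t
    using X[OF that] by (auto simp: is_stable_integral_def in_Lalpha_def)
  have [measurable]: "h t k \<in> borel_measurable \<mu>" if "t \<in> I" for t k
    by (rule borel_measurable_simple_function[OF h(1)[OF that]])
  have [measurable]: "?S t k \<in> borel_measurable Q" if "t \<in> I" for t k
    by (rule simple_stable_integral_measurable[OF M h[OF that]])
  have "(\<lambda>k. \<Sum>t\<in>I. \<integral>\<^sup>+ s. ennreal (\<bar>h t k s - g t s\<bar> powr \<alpha>) \<partial>\<mu>) \<longlonglongrightarrow> (\<Sum>t\<in>I. 0)"
    by (intro tendsto_sum Lalpha)
  then have "\<forall>\<^sub>F k in sequentially. (\<Sum>t\<in>I. \<integral>\<^sup>+ s. ennreal (\<bar>h t k s - g t s\<bar> powr \<alpha>) \<partial>\<mu>) < 1"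
    by (rule order_tendstoD) simp
  moreover have "(\<lambda>k. \<Sum>t\<in>I. prob {\<omega> \<in> space Q. L / 2 < \<bar>?S t k \<omega> - X t \<omega>\<bar>}) \<longlonglongrightarrow> (\<Sum>t\<in>I. 0)"
    by (intro tendsto_sum mp[OF spec[OF inprob[unfolded converges_in_prob_def], of _ "L / 2"]])
       (use pos in auto)
  then have "\<forall>\<^sub>F k in sequentially. (\<Sum>t\<in>I. prob {\<omega> \<in> space Q. L / 2 < \<bar>?S t k \<omega> - X t \<omega>\<bar>}) < \<eta>"
    by (rule order_tendstoD) (simp add: \<eta>)
  ultimately have "\<forall>\<^sub>F k in sequentially.
      (\<Sum>t\<in>I. \<integral>\<^sup>+ s. ennreal (\<bar>h t k s - g t s\<bar> powr \<alpha>) \<partial>\<mu>) < 1 \<and>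
      (\<Sum>t\<in>I. prob {\<omega> \<in> space Q. L / 2 < \<bar>?S t k \<omega> - X t \<omega>\<bar>}) < \<eta>"
    by (rule eventually_conj)
  from eventually_happens'[OF sequentially_bot this] obtain k where close: "(\<Sum>t\<in>I. \<integral>\<^sup>+ s. ennreal (\<bar>h t k s - g t s\<bar> powr \<alpha>) \<partial>\<mu>) < 1"
    and close_prob: "(\<Sum>t\<in>I. prob {\<omega> \<in> space Q. L / 2 < \<bar>?S t k \<omega> - X t \<omega>\<bar>}) < \<eta>"
    by (elim exE conjE)
  \<comment> \<open>A single error term that serves all indices at once, so that it can be added to the common
    dominating function \<open>G\<close>.\<close>
  define E where "E s = (\<Sum>t\<in>I. ennreal (\<bar>h t k s - g t s\<bar> powr \<alpha>))" for s
  have Em[measurable]: "E \<in> borel_measurable \<mu>" unfolding E_def[abs_def] by measurable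
  have E_int: "(\<integral>\<^sup>+ s. E s \<partial>\<mu>) \<le> 1"
    unfolding E_def using close by (subst nn_integral_sum) auto
  have h_le: "ennreal (\<bar>h t k s\<bar> powr \<alpha>) \<le> ennreal (2 powr \<alpha>) * (ennreal (\<bar>g t s\<bar> powr \<alpha>) + E s)"
    if t: "t \<in> I" for t s
  proof -
    have "ennreal (\<bar>h t k s\<bar> powr \<alpha>) \<le> ennreal (2 powr \<alpha>) * (ennreal (\<bar>g t s\<bar> powr \<alpha>) + ennreal (\<bar>h t k s - g t s\<bar> powr \<alpha>))"
      using ennreal_leI[OF abs_powr_le_add_diff[OF \<alpha>(1), of "h t k s" "g t s"]]
      by (simp add: ennreal_mult' ennreal_plus)
    also have "ennreal (\<bar>h t k s - g t s\<bar> powr \<alpha>) \<le> E s"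
      unfolding E_def using member_le_sum[OF t, of "\<lambda>t. ennreal (\<bar>h t k s - g t s\<bar> powr \<alpha>)"] I by simp
    finally show ?thesis by (simp add: add_left_mono mult_left_mono)
  qed
  have approx_int: "(\<integral>\<^sup>+ s. ennreal (2 powr \<alpha>) * (H s + E s) \<partial>\<mu>) \<le> ennreal (2 powr \<alpha> * (b + 1))"
    if [measurable]: "H \<in> borel_measurable \<mu>" and "(\<integral>\<^sup>+ s. H s \<partial>\<mu>) \<le> ennreal b" "0 \<le> b" for H b
  proof -
    have "(\<integral>\<^sup>+ s. ennreal (2 powr \<alpha>) * (H s + E s) \<partial>\<mu>)
        = ennreal (2 powr \<alpha>) * ((\<integral>\<^sup>+ s. H s \<partial>\<mu>) + (\<integral>\<^sup>+ s. E s \<partial>\<mu>))"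
      by (simp add: nn_integral_cmult nn_integral_add)
    also have "\<dots> \<le> ennreal (2 powr \<alpha>) * (ennreal b + 1)"
      by (intro mult_left_mono add_mono that E_int) simp
    also have "\<dots> = ennreal (2 powr \<alpha> * (b + 1))"
      using \<open>0 \<le> b\<close> by (simp add: ennreal_mult' ennreal_plus)
    finally show ?thesis .
  qed
  have tail: "prob {\<omega> \<in> space Q. \<exists>t\<in>I. L / 2 < \<bar>?S t k \<omega>\<bar>}
      \<le> 8 * (2 powr \<alpha> * (B + 1)) * (q / (L / 2)) powr \<alpha>
       + card I * (2 * exp 1 * (8 * (2 powr \<alpha> * (D + 1)) * (q / (L / 2)) powr \<alpha>) powr q)"
  proof (rule simple_stable_integral_max_tail[OF \<alpha> Q M I h])
    show "ennreal (\<bar>h t k s\<bar> powr \<alpha>) \<le> ennreal (2 powr \<alpha>) * (G s + E s)"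
      if "t \<in> I" "s \<in> space \<mu>" for t s
      by (rule order.trans[OF h_le[OF that(1)]]) (intro mult_left_mono add_mono G that order_refl zero_le)
    show "(\<integral>\<^sup>+ s. ennreal (2 powr \<alpha>) * (G s + E s) \<partial>\<mu>) \<le> ennreal (2 powr \<alpha> * (B + 1))"
      by (rule approx_int[OF Gm B])
    show "(\<integral>\<^sup>+ s. ennreal (\<bar>h t k s\<bar> powr \<alpha>) \<partial>\<mu>) \<le> ennreal (2 powr \<alpha> * (D + 1))" if t: "t \<in> I" for t
    proof -
      have "(\<integral>\<^sup>+ s. ennreal (\<bar>h t k s\<bar> powr \<alpha>) \<partial>\<mu>)
          \<le> (\<integral>\<^sup>+ s. ennreal (2 powr \<alpha>) * (ennreal (\<bar>g t s\<bar> powr \<alpha>) + E s) \<partial>\<mu>)"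
        by (intro nn_integral_mono h_le t)
      also have "\<dots> \<le> ennreal (2 powr \<alpha> * (D + 1))"
        using t by (intro approx_int D) measurable
      finally show ?thesis .
    qed
  qed (use B D pos in auto)
  have "prob {\<omega> \<in> space Q. \<exists>t\<in>I. L < \<bar>X t \<omega>\<bar>}
      \<le> prob ({\<omega> \<in> space Q. \<exists>t\<in>I. L / 2 < \<bar>?S t k \<omega>\<bar>} \<union> (\<Union>t\<in>I. {\<omega> \<in> space Q. L / 2 < \<bar>?S t k \<omega> - X t \<omega>\<bar>}))"
  proof (rule finite_measure_mono)
    show "{\<omega> \<in> space Q. \<exists>t\<in>I. L < \<bar>X t \<omega>\<bar>}
      \<subseteq> {\<omega> \<in> space Q. \<exists>t\<in>I. L / 2 < \<bar>?S t k \<omega>\<bar>} \<union> (\<Union>t\<in>I. {\<omega> \<in> space Q. L / 2 < \<bar>?S t k \<omega> - X t \<omega>\<bar>})"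
    proof
      fix \<omega> assume "\<omega> \<in> {\<omega> \<in> space Q. \<exists>t\<in>I. L < \<bar>X t \<omega>\<bar>}"
      then obtain t where t: "\<omega> \<in> space Q" "t \<in> I" "L < \<bar>X t \<omega>\<bar>" by blast
      have "L / 2 < \<bar>?S t k \<omega>\<bar> \<or> L / 2 < \<bar>?S t k \<omega> - X t \<omega>\<bar>" using t(3) by linarith
      then show "\<omega> \<in> {\<omega> \<in> space Q. \<exists>t\<in>I. L / 2 < \<bar>?S t k \<omega>\<bar>} \<union> (\<Union>t\<in>I. {\<omega> \<in> space Q. L / 2 < \<bar>?S t k \<omega> - X t \<omega>\<bar>})"
        using t by blast
    qed
    show "{\<omega> \<in> space Q. \<exists>t\<in>I. L / 2 < \<bar>?S t k \<omega>\<bar>} \<union> (\<Union>t\<in>I. {\<omega> \<in> space Q. L / 2 < \<bar>?S t k \<omega> - X t \<omega>\<bar>}) \<in> events"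
      using I by (intro sets.Un sets.finite_UN sets.sets_Collect_finite_Ex) measurable
  qed
  also have "\<dots> \<le> prob {\<omega> \<in> space Q. \<exists>t\<in>I. L / 2 < \<bar>?S t k \<omega>\<bar>}
      + prob (\<Union>t\<in>I. {\<omega> \<in> space Q. L / 2 < \<bar>?S t k \<omega> - X t \<omega>\<bar>})"
    using I by (intro measure_Un_le sets.finite_UN sets.sets_Collect_finite_Ex) measurable
  also have "prob (\<Union>t\<in>I. {\<omega> \<in> space Q. L / 2 < \<bar>?S t k \<omega> - X t \<omega>\<bar>})
      \<le> (\<Sum>t\<in>I. prob {\<omega> \<in> space Q. L / 2 < \<bar>?S t k \<omega> - X t \<omega>\<bar>})"
    by (intro finite_measure_subadditive_finite I) auto
  finally show "prob {\<omega> \<in> space Q. \<exists>t\<in>I. L < \<bar>X t \<omega>\<bar>} \<le> ?bound + \<eta>"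
    using tail close_prob by (simp add: mult.commute[of 2 q])
qed

section \<open>Moments from tails\<close>

text \<open>For \<open>w > 1\<close> only the term of the dyadic interval containing \<open>w\<close> is needed: if
  \<open>2 ^ k < w \<le> 2 ^ Suc k\<close> then the \<open>k\<close>-th coefficient is \<open>(2 ^ Suc k) powr \<beta>\<close>.\<close>

lemma dyadic_layer_cake:
  fixes w \<beta> :: real
  assumes "0 < \<beta>" "0 \<le> w"
  shows "ennreal (w powr \<beta>) \<le> 1 + (\<Sum>k. ennreal (2 powr \<beta> * (2 powr \<beta>) ^ k) * indicator {x. 2 ^ k < x} w)"
proof (cases "w \<le> 1")
  case True
  then have "w powr \<beta> \<le> 1" using assms by (intro powr_le1) auto
  then have "ennreal (w powr \<beta>) \<le> 1" by (simp add: ennreal_le_1)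
  also have "\<dots> \<le> 1 + (\<Sum>k. ennreal (2 powr \<beta> * (2 powr \<beta>) ^ k) * indicator {x. 2 ^ k < x} w)"
    by simp
  finally show ?thesis .
next
  case False
  have single_le_suminf: "F k \<le> (\<Sum>k. F k)" for F :: "nat \<Rightarrow> ennreal" and k
    using sum_le_suminf[of F "{k}"] by simp
  obtain N where N: "w < 2 ^ N" using real_arch_pow[of 2 w] by auto
  define k where "k = (LEAST k. w \<le> 2 ^ Suc k)"
  have "w \<le> 2 ^ Suc N" using N zero_less_power[of "2::real" N] unfolding power_Suc by linarith
  then have k: "w \<le> 2 ^ Suc k" unfolding k_def by (rule LeastI)
  have k': "2 ^ k < w"
  proof (cases k)
    case (Suc j)
    then have "\<not> w \<le> 2 ^ Suc j" using not_less_Least[of j "\<lambda>k. w \<le> 2 ^ Suc k"] by (simp add: k_def)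
    then show ?thesis using Suc by simp
  qed (use False in simp)
  have "w powr \<beta> \<le> (2 ^ Suc k) powr \<beta>" using assms k by (intro powr_mono2) auto
  also have "\<dots> = 2 powr \<beta> * (2 powr \<beta>) ^ k"
    by (simp add: powr_mult powr_realpow[symmetric] powr_powr mult.commute)
  finally have "ennreal (w powr \<beta>) \<le> ennreal (2 powr \<beta> * (2 powr \<beta>) ^ k) * indicator {x. 2 ^ k < x} w"
    using k' by (simp add: ennreal_leI)
  also have "\<dots> \<le> (\<Sum>k. ennreal (2 powr \<beta> * (2 powr \<beta>) ^ k) * indicator {x. 2 ^ k < x} w)"
    by (rule single_le_suminf)
  also have "\<dots> \<le> 1 + \<dots>" by simp
  finally show ?thesis .
qed

lemma (in prob_space) moment_bound_from_tail:
  assumes W[measurable]: "W \<in> borel_measurable M" and W_nonneg: "\<And>\<omega>. \<omega> \<in> space M \<Longrightarrow> 0 \<le> W \<omega>"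
    and \<beta>: "0 < \<beta>" "\<beta> < \<alpha>" and "0 \<le> C"
    and tail: "\<And>l. 1 \<le> l \<Longrightarrow> prob {\<omega> \<in> space M. l < W \<omega>} \<le> C * l powr (- \<alpha>)"
  shows "(\<integral>\<^sup>+ \<omega>. ennreal (W \<omega> powr \<beta>) \<partial>M) \<le> ennreal (1 + 2 powr \<beta> * C / (1 - 2 powr (\<beta> - \<alpha>)))"
proof -
  define r where "r = (2::real) powr (\<beta> - \<alpha>)"
  have r: "0 \<le> r" "r < 1" using \<beta> by (auto simp: r_def powr_less_one)
  have "(\<integral>\<^sup>+ \<omega>. ennreal (W \<omega> powr \<beta>) \<partial>M)
      \<le> (\<integral>\<^sup>+ \<omega>. 1 + (\<Sum>k. ennreal (2 powr \<beta> * (2 powr \<beta>) ^ k) * indicator {x. 2 ^ k < x} (W \<omega>)) \<partial>M)"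
    by (intro nn_integral_mono dyadic_layer_cake \<beta> W_nonneg)
  also have "\<dots> = 1 + (\<Sum>k. \<integral>\<^sup>+ \<omega>. ennreal (2 powr \<beta> * (2 powr \<beta>) ^ k) * indicator {x. 2 ^ k < x} (W \<omega>) \<partial>M)"
    by (subst nn_integral_add) (auto simp: nn_integral_suminf emeasure_space_1)
  also have "(\<Sum>k. \<integral>\<^sup>+ \<omega>. ennreal (2 powr \<beta> * (2 powr \<beta>) ^ k) * indicator {x. 2 ^ k < x} (W \<omega>) \<partial>M)
      \<le> (\<Sum>k. ennreal (2 powr \<beta> * C * r ^ k))"
  proof (intro suminf_le allI)
    fix k
    have "(\<integral>\<^sup>+ \<omega>. ennreal (2 powr \<beta> * (2 powr \<beta>) ^ k) * indicator {x. 2 ^ k < x} (W \<omega>) \<partial>M)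
        = (\<integral>\<^sup>+ \<omega>. ennreal (2 powr \<beta> * (2 powr \<beta>) ^ k) * indicator {\<omega> \<in> space M. 2 ^ k < W \<omega>} \<omega> \<partial>M)"
      by (intro nn_integral_cong) (auto simp: indicator_def)
    also have "\<dots> = ennreal (2 powr \<beta> * (2 powr \<beta>) ^ k) * ennreal (prob {\<omega> \<in> space M. 2 ^ k < W \<omega>})"
      by (subst nn_integral_cmult_indicator) (auto simp: emeasure_eq_measure)
    also have "\<dots> = ennreal (2 powr \<beta> * (2 powr \<beta>) ^ k * prob {\<omega> \<in> space M. 2 ^ k < W \<omega>})"
      by (simp add: ennreal_mult')
    also have "\<dots> \<le> ennreal (2 powr \<beta> * (2 powr \<beta>) ^ k * (C * (2 ^ k) powr (- \<alpha>)))"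
      by (intro ennreal_leI mult_left_mono tail) auto
    also have "2 powr \<beta> * (2 powr \<beta>) ^ k * (C * (2 ^ k) powr (- \<alpha>)) = 2 powr \<beta> * C * r ^ k"
    proof -
      have "((2::real) ^ k) powr (- \<alpha>) = (2 powr (- \<alpha>)) ^ k"
        by (simp add: powr_realpow[symmetric] powr_powr mult.commute)
      moreover have "r = 2 powr \<beta> * 2 powr (- \<alpha>)" by (simp add: r_def powr_add[symmetric])
      ultimately show ?thesis by (simp add: power_mult_distrib)
    qed
    finally show "(\<integral>\<^sup>+ \<omega>. ennreal (2 powr \<beta> * (2 powr \<beta>) ^ k) * indicator {x. 2 ^ k < x} (W \<omega>) \<partial>M)
        \<le> ennreal (2 powr \<beta> * C * r ^ k)" .
  qed auto
  also have "(\<Sum>k. ennreal (2 powr \<beta> * C * r ^ k)) = ennreal (2 powr \<beta> * C / (1 - r))"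
  proof -
    have "(\<lambda>k. 2 powr \<beta> * C * r ^ k) sums (2 powr \<beta> * C * (1 / (1 - r)))"
      using r by (intro sums_mult geometric_sums) auto
    then show ?thesis
      using r \<open>0 \<le> C\<close> by (intro suminf_ennreal_eq) auto
  qed
  also have "1 + ennreal (2 powr \<beta> * C / (1 - r)) = ennreal (1 + 2 powr \<beta> * C / (1 - r))"
    using r \<open>0 \<le> C\<close> by (simp add: ennreal_plus)
  finally show ?thesis by (simp add: r_def add_left_mono)
qed

section \<open>The kernel of a nonsingular action\<close>

text \<open>The density of the shifted measure is the Jacobian that makes the change of variables \<open>\<phi> t\<close>
  preserve the integral. The inequality avoids the question whether the density is finite, as
  \<open>enn2real\<close> sends the value \<open>\<infinity>\<close> to 0 and so can only decrease the kernel.\<close>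

lemma action_kernel_norm_le:
  fixes \<phi> :: "'i::ab_group_add \<Rightarrow> 's \<Rightarrow> 's"
  assumes "0 < \<alpha>" and "sigma_finite_measure \<mu>" and f: "in_Lalpha \<alpha> \<mu> f"
    and \<phi>: "nonsingular_action \<mu> \<phi>" and c: "sign_cocycle \<mu> \<phi> c"
  shows "(\<integral>\<^sup>+ s. ennreal (\<bar>action_kernel \<alpha> \<mu> \<phi> c f t s\<bar> powr \<alpha>) \<partial>\<mu>)
    \<le> (\<integral>\<^sup>+ s. ennreal (\<bar>f s\<bar> powr \<alpha>) \<partial>\<mu>)"
proof -
  interpret sigma_finite_measure \<mu> by fact
  let ?N = "shifted_measure \<mu> \<phi> t"
  have \<phi>m[measurable]: "\<phi> u \<in> measurable \<mu> \<mu>" for u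
    using \<phi> by (simp add: nonsingular_action_def)
  have fm[measurable]: "f \<in> borel_measurable \<mu>"
    using f by (simp add: in_Lalpha_def)
  have ac: "absolutely_continuous \<mu> ?N"
    using \<phi> by (simp add: nonsingular_action_def)
  have sets: "sets ?N = sets \<mu>" by (simp add: shifted_measure_def)
  have "(\<integral>\<^sup>+ s. ennreal (\<bar>action_kernel \<alpha> \<mu> \<phi> c f t s\<bar> powr \<alpha>) \<partial>\<mu>)
      \<le> (\<integral>\<^sup>+ s. RN_deriv \<mu> ?N s * ennreal (\<bar>f (\<phi> t s)\<bar> powr \<alpha>) \<partial>\<mu>)"
  proof (rule nn_integral_mono)
    fix s assume s: "s \<in> space \<mu>"
    define \<rho> where "\<rho> = RN_deriv \<mu> ?N s"
    have "c t s = 1 \<or> c t s = - 1" using c s by (auto simp: sign_cocycle_def)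
    then have "\<bar>c t s\<bar> = 1" by auto
    then have "\<bar>action_kernel \<alpha> \<mu> \<phi> c f t s\<bar> powr \<alpha> = (enn2real \<rho> powr (1 / \<alpha>) * \<bar>f (\<phi> t s)\<bar>) powr \<alpha>"
      by (simp add: action_kernel_def abs_mult \<rho>_def)
    also have "\<dots> = (enn2real \<rho> powr (1 / \<alpha>)) powr \<alpha> * \<bar>f (\<phi> t s)\<bar> powr \<alpha>"
      by (rule powr_mult)
    also have "(enn2real \<rho> powr (1 / \<alpha>)) powr \<alpha> = enn2real \<rho>"
      using \<open>0 < \<alpha>\<close> by (simp add: powr_powr)
    finally have "ennreal (\<bar>action_kernel \<alpha> \<mu> \<phi> c f t s\<bar> powr \<alpha>) = ennreal (enn2real \<rho>) * ennreal (\<bar>f (\<phi> t s)\<bar> powr \<alpha>)"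
      by (simp add: ennreal_mult')
    also have "\<dots> \<le> \<rho> * ennreal (\<bar>f (\<phi> t s)\<bar> powr \<alpha>)"
      by (intro mult_right_mono zero_le) (cases \<rho>; simp)
    finally show "ennreal (\<bar>action_kernel \<alpha> \<mu> \<phi> c f t s\<bar> powr \<alpha>)
        \<le> RN_deriv \<mu> ?N s * ennreal (\<bar>f (\<phi> t s)\<bar> powr \<alpha>)"
      by (simp add: \<rho>_def)
  qed
  also have "\<dots> = (\<integral>\<^sup>+ s. ennreal (\<bar>f (\<phi> t s)\<bar> powr \<alpha>) \<partial>?N)"
    by (rule RN_deriv_nn_integral[OF ac sets, symmetric]) measurable
  also have "\<dots> = (\<integral>\<^sup>+ s. ennreal (\<bar>f (\<phi> t (\<phi> (- t) s))\<bar> powr \<alpha>) \<partial>\<mu>)"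
    unfolding shifted_measure_def by (rule nn_integral_distr) measurable
  also have "\<dots> = (\<integral>\<^sup>+ s. ennreal (\<bar>f s\<bar> powr \<alpha>) \<partial>\<mu>)"
  proof (rule nn_integral_cong)
    fix s assume s: "s \<in> space \<mu>"
    have "\<phi> t (\<phi> (- t) s) = \<phi> (t + - t) s" using \<phi> s by (simp only: nonsingular_action_def)
    also have "\<dots> = s" using \<phi> s by (simp add: nonsingular_action_def)
    finally show "ennreal (\<bar>f (\<phi> t (\<phi> (- t) s))\<bar> powr \<alpha>) = ennreal (\<bar>f s\<bar> powr \<alpha>)" by simp
  qed
  finally show ?thesis .
qed

section \<open>Maxima over cubes\<close>

lemma cube_finite_card:
  shows "finite (cube n :: (int ^ 'n) set)" and "card (cube n :: (int ^ 'n) set) \<le> n ^ CARD('n)"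
proof -
  let ?F = "(UNIV :: 'n set) \<rightarrow>\<^sub>E {0..<int n}"
  have inj: "inj_on vec_nth (cube n :: (int ^ 'n) set)"
    by (auto simp: inj_on_def vec_eq_iff)
  have sub: "vec_nth ` (cube n :: (int ^ 'n) set) \<subseteq> ?F"
    by (auto simp: cube_def less_eq_vec_def PiE_def Pi_def)
  have fin: "finite ?F" by (intro finite_PiE) auto
  show "finite (cube n :: (int ^ 'n) set)"
    using inj finite_subset[OF sub fin] by (rule finite_imageD[rotated])
  have "card (cube n :: (int ^ 'n) set) \<le> card ?F"
    by (rule card_inj_on_le[OF inj sub fin])
  then show "card (cube n :: (int ^ 'n) set) \<le> n ^ CARD('n)"
    by (simp add: card_PiE)
qed

lemma zero_in_cube: "1 \<le> n \<Longrightarrow> 0 \<in> (cube n :: (int ^ 'n) set)"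
  by (auto simp: cube_def less_eq_vec_def)

lemma same_fdd_nn_integral:
  assumes "same_fdd P Y Q X" and "finite I"
    and Y: "\<And>i. i \<in> I \<Longrightarrow> Y i \<in> borel_measurable P" and X: "\<And>i. i \<in> I \<Longrightarrow> X i \<in> borel_measurable Q"
    and F: "F \<in> borel_measurable (\<Pi>\<^sub>M i\<in>I. borel)"
  shows "(\<integral>\<^sup>+ \<omega>. F (\<lambda>i\<in>I. Y i \<omega>) \<partial>P) = (\<integral>\<^sup>+ \<omega>. F (\<lambda>i\<in>I. X i \<omega>) \<partial>Q)"
proof -
  have "(\<integral>\<^sup>+ \<omega>. F (\<lambda>i\<in>I. Y i \<omega>) \<partial>P) = (\<integral>\<^sup>+ x. F x \<partial>distr P (\<Pi>\<^sub>M i\<in>I. borel) (\<lambda>\<omega>. \<lambda>i\<in>I. Y i \<omega>))"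
    using Y F by (subst nn_integral_distr) (auto intro!: measurable_restrict)
  also have "\<dots> = (\<integral>\<^sup>+ x. F x \<partial>distr Q (\<Pi>\<^sub>M i\<in>I. borel) (\<lambda>\<omega>. \<lambda>i\<in>I. X i \<omega>))"
    using assms(1,2) by (simp add: same_fdd_def)
  also have "\<dots> = (\<integral>\<^sup>+ \<omega>. F (\<lambda>i\<in>I. X i \<omega>) \<partial>Q)"
    using X F by (subst nn_integral_distr) (auto intro!: measurable_restrict)
  finally show ?thesis .
qed

lemma same_fdd_partial_max_moment:
  fixes Y :: "int ^ 'n \<Rightarrow> 'w \<Rightarrow> real" and X :: "int ^ 'n \<Rightarrow> 'v \<Rightarrow> real"
  assumes "same_fdd P Y Q X"
    and "\<And>t. Y t \<in> borel_measurable P" and "\<And>t. X t \<in> borel_measurable Q"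
  shows "(\<integral>\<^sup>+ \<omega>. ennreal (partial_max Y n \<omega> powr \<beta>) \<partial>P) = (\<integral>\<^sup>+ \<omega>. ennreal (partial_max X n \<omega> powr \<beta>) \<partial>Q)"
proof -
  let ?I = "cube n :: (int ^ 'n) set"
  let ?F = "\<lambda>x :: int ^ 'n \<Rightarrow> real. ennreal (Max ((\<lambda>t. \<bar>x t\<bar>) ` ?I) powr \<beta>)"
  have "(\<lambda>x :: int ^ 'n \<Rightarrow> real. Max ((\<lambda>t. \<bar>x t\<bar>) ` ?I)) \<in> borel_measurable (\<Pi>\<^sub>M i\<in>?I. borel)"
    by (rule borel_measurable_Max[OF cube_finite_card(1)]) measurable
  then have F: "?F \<in> borel_measurable (\<Pi>\<^sub>M i\<in>?I. borel)" by measurable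
  have "?F (\<lambda>t\<in>?I. Z t) = ennreal (Max ((\<lambda>t. \<bar>Z t\<bar>) ` ?I) powr \<beta>)" for Z :: "int ^ 'n \<Rightarrow> real"
    by (intro arg_cong[where f = "\<lambda>A. ennreal (Max A powr \<beta>)"] image_cong) auto
  then show ?thesis
    using same_fdd_nn_integral[OF assms(1) cube_finite_card(1) assms(2,3) F]
    by (simp add: partial_max_def)
qed

text \<open>The Bochner integral in \<open>b_seq\<close> would be 0 for a function that is not integrable; the maximum over
  the cube is at most the sum, so it is integrable, and the same comparison gives a crude bound for
  each \<open>n\<close>.\<close>

lemma nn_integral_Max_kernel:
  fixes k :: "int ^ 'n \<Rightarrow> 's \<Rightarrow> real"
  assumes "0 < \<alpha>" "1 \<le> n" and k[measurable]: "\<And>t. k t \<in> borel_measurable \<mu>"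
    and D: "\<And>t. (\<integral>\<^sup>+ s. ennreal (\<bar>k t s\<bar> powr \<alpha>) \<partial>\<mu>) \<le> ennreal D" "0 \<le> D"
  shows "(\<integral>\<^sup>+ s. ennreal (Max ((\<lambda>t. \<bar>k t s\<bar> powr \<alpha>) ` cube n)) \<partial>\<mu>) = ennreal (b_seq \<alpha> \<mu> k n powr \<alpha>)"
    and "b_seq \<alpha> \<mu> k n powr \<alpha> \<le> real n ^ CARD('n) * D"
proof -
  let ?I = "cube n :: (int ^ 'n) set"
  let ?G = "\<lambda>s. Max ((\<lambda>t. \<bar>k t s\<bar> powr \<alpha>) ` ?I)"
  note fin = cube_finite_card(1)[where 'n = 'n, of n]
  have G_m[measurable]: "?G \<in> borel_measurable \<mu>"
    by (rule borel_measurable_Max[OF fin]) measurable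
  have ge: "\<bar>k t s\<bar> powr \<alpha> \<le> ?G s" if "t \<in> ?I" for t s
    using that fin by (intro Max_ge) auto
  have G_nonneg: "0 \<le> ?G s" for s
    using ge[OF zero_in_cube[OF \<open>1 \<le> n\<close>], of s] by (rule order.trans[rotated]) simp
  have "?G s \<le> (\<Sum>t\<in>?I. \<bar>k t s\<bar> powr \<alpha>)" for s
    using fin zero_in_cube[OF \<open>1 \<le> n\<close>] by (subst Max_le_iff) (auto intro!: member_le_sum)
  then have "(\<integral>\<^sup>+ s. ennreal (?G s) \<partial>\<mu>) \<le> (\<integral>\<^sup>+ s. (\<Sum>t\<in>?I. ennreal (\<bar>k t s\<bar> powr \<alpha>)) \<partial>\<mu>)"
    by (intro nn_integral_mono) (simp add: sum_ennreal ennreal_leI)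
  also have "\<dots> = (\<Sum>t\<in>?I. \<integral>\<^sup>+ s. ennreal (\<bar>k t s\<bar> powr \<alpha>) \<partial>\<mu>)"
    by (rule nn_integral_sum) measurable
  also have "\<dots> \<le> (\<Sum>t\<in>?I. ennreal D)"
    by (intro sum_mono D)
  also have "\<dots> = ennreal (card ?I * D)"
    using D(2) by (simp add: ennreal_mult' ennreal_of_nat_eq_real_of_nat)
  also have "\<dots> \<le> ennreal (real n ^ CARD('n) * D)"
    using cube_finite_card(2)[where 'n = 'n, of n] D(2)
    by (intro ennreal_leI mult_right_mono) (simp_all add: of_nat_power[symmetric] del: of_nat_power)
  finally have le: "(\<integral>\<^sup>+ s. ennreal (?G s) \<partial>\<mu>) \<le> ennreal (real n ^ CARD('n) * D)" .
  have "integrable \<mu> ?G"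
    using le by (intro integrableI_nonneg) (auto simp: G_nonneg intro: le_less_trans)
  then have "(\<integral>\<^sup>+ s. ennreal (?G s) \<partial>\<mu>) = ennreal (\<integral>s. ?G s \<partial>\<mu>)"
    by (intro nn_integral_eq_integral) (auto simp: G_nonneg)
  also have "(\<integral>s. ?G s \<partial>\<mu>) = b_seq \<alpha> \<mu> k n powr \<alpha>"
    using \<open>0 < \<alpha>\<close> G_nonneg by (simp add: b_seq_def powr_powr integral_nonneg)
  finally show eq: "(\<integral>\<^sup>+ s. ennreal (?G s) \<partial>\<mu>) = ennreal (b_seq \<alpha> \<mu> k n powr \<alpha>)" .
  show "b_seq \<alpha> \<mu> k n powr \<alpha> \<le> real n ^ CARD('n) * D"
    using le D(2) unfolding eq by simp
qed

text \<open>Below the threshold of the eventual bound the crude bound is bounded by a constant, and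
  \<open>n powr \<theta> \<ge> 1\<close> for \<open>n \<ge> 1\<close>.\<close>

lemma eventually_powr_bound_imp_bound:
  fixes g :: "nat \<Rightarrow> real"
  assumes "\<forall>\<^sub>F n in sequentially. g n \<le> c * real n powr \<theta>" and "0 < c" "0 \<le> \<theta>" "0 \<le> D"
    and crude: "\<And>n. 1 \<le> n \<Longrightarrow> g n \<le> real n ^ d * D"
  obtains C where "0 \<le> C" "\<And>n. 1 \<le> n \<Longrightarrow> g n \<le> C * real n powr \<theta>"
proof -
  obtain N where N: "\<And>n. N \<le> n \<Longrightarrow> g n \<le> c * real n powr \<theta>"
    using assms(1) by (auto simp: eventually_sequentially)
  have "g n \<le> (c + real N ^ d * D) * real n powr \<theta>" if n: "1 \<le> n" for n
  proof (cases "N \<le> n")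
    case True
    then have "g n \<le> c * real n powr \<theta>" by (rule N)
    also have "\<dots> \<le> (c + real N ^ d * D) * real n powr \<theta>"
      using \<open>0 \<le> D\<close> by (intro mult_right_mono) auto
    finally show ?thesis .
  next
    case False
    have one: "1 \<le> real n powr \<theta>" using n \<open>0 \<le> \<theta>\<close> by (simp add: ge_one_powr_ge_zero)
    have "g n \<le> real N ^ d * D"
      using crude[OF n] False \<open>0 \<le> D\<close> mult_right_mono[OF power_mono[of "real n" "real N" d], of D] by simp
    also have "\<dots> \<le> (c + real N ^ d * D) * 1" using \<open>0 < c\<close> by simp
    also have "\<dots> \<le> (c + real N ^ d * D) * real n powr \<theta>"
      using \<open>0 < c\<close> \<open>0 \<le> D\<close> by (intro mult_left_mono one) auto
    finally show ?thesis .
  qed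
  moreover have "0 \<le> c + real N ^ d * D" using \<open>0 < c\<close> \<open>0 \<le> D\<close> by simp
  ultimately show ?thesis by (rule that[rotated])
qed

text \<open>With \<open>L = l * n powr (\<theta> / \<alpha>)\<close> the factor \<open>n powr \<theta>\<close> of the first summand cancels, and in the
  second the exponent \<open>q = d / \<theta>\<close> produces \<open>n powr (- d)\<close>, which cancels the number of indices \<open>N\<close>.
  The remaining power \<open>l powr (- \<alpha> * q)\<close> is at most \<open>l powr (- \<alpha>)\<close>, as \<open>q \<ge> 1\<close> and \<open>l \<ge> 1\<close>.\<close>

lemma max_tail_rate:
  fixes \<alpha> \<theta> c D l q :: real and n d N :: nat
  assumes "0 < \<alpha>" "0 < \<theta>" "\<theta> \<le> d" "0 \<le> c" "0 \<le> D" "1 \<le> l" "1 \<le> n" "N \<le> n ^ d"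
    and q: "q = d / \<theta>"
  defines "A \<equiv> 8 * (2 powr \<alpha> * (D + 1)) * (2 * q) powr \<alpha>"
  shows "8 * (2 powr \<alpha> * (c * real n powr \<theta> + 1)) * (2 * q / (l * real n powr (\<theta> / \<alpha>))) powr \<alpha>
      + N * (2 * exp 1 * (8 * (2 powr \<alpha> * (D + 1)) * (2 * q / (l * real n powr (\<theta> / \<alpha>))) powr \<alpha>) powr q)
    \<le> (8 * (2 powr \<alpha> * (c + 1)) * (2 * q) powr \<alpha> + 2 * exp 1 * A powr q) * l powr (- \<alpha>)"
proof -
  have q1: "1 \<le> q" using assms by (simp add: q)
  have n1: "1 \<le> real n" using \<open>1 \<le> n\<close> by simp
  have ratio: "(2 * q / (l * real n powr (\<theta> / \<alpha>))) powr \<alpha> = (2 * q) powr \<alpha> * l powr (- \<alpha>) * real n powr (- \<theta>)"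
  proof -
    have "(2 * q / (l * real n powr (\<theta> / \<alpha>))) powr \<alpha> = (2 * q) powr \<alpha> / (l powr \<alpha> * (real n powr (\<theta> / \<alpha>)) powr \<alpha>)"
      by (simp only: powr_divide powr_mult)
    then show ?thesis using \<open>0 < \<alpha>\<close> by (simp add: powr_powr powr_minus field_simps)
  qed
  have cancel: "real n powr \<theta> * real n powr (- \<theta>) = 1" using n1 by (simp add: powr_add[symmetric])
  have small: "real n powr (- \<theta>) \<le> 1" using n1 \<open>0 < \<theta>\<close> by (simp add: powr_minus inverse_le_1_iff ge_one_powr_ge_zero)
  have "8 * (2 powr \<alpha> * (c * real n powr \<theta> + 1)) * ((2 * q) powr \<alpha> * l powr (- \<alpha>) * real n powr (- \<theta>))
      = 8 * 2 powr \<alpha> * (2 * q) powr \<alpha> * l powr (- \<alpha>) * (c * (real n powr \<theta> * real n powr (- \<theta>)) + real n powr (- \<theta>))"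
    by (simp add: algebra_simps)
  also have "\<dots> \<le> 8 * 2 powr \<alpha> * (2 * q) powr \<alpha> * l powr (- \<alpha>) * (c * 1 + 1)"
    unfolding cancel using small by (intro mult_left_mono add_left_mono) auto
  finally have big_jumps: "8 * (2 powr \<alpha> * (c * real n powr \<theta> + 1)) * ((2 * q) powr \<alpha> * l powr (- \<alpha>) * real n powr (- \<theta>))
      \<le> 8 * (2 powr \<alpha> * (c + 1)) * (2 * q) powr \<alpha> * l powr (- \<alpha>)"
    by (simp add: mult_ac)
  have "N * (2 * exp 1 * (A * l powr (- \<alpha>) * real n powr (- \<theta>)) powr q)
      = 2 * exp 1 * A powr q * (l powr (- \<alpha>)) powr q * (N * (real n powr (- \<theta>)) powr q)"
    by (simp add: powr_mult mult_ac)
  also have "\<dots> \<le> 2 * exp 1 * A powr q * l powr (- \<alpha>) * 1"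
  proof (intro mult_mono mult_left_mono)
    have "(l powr (- \<alpha>)) powr q \<le> (l powr (- \<alpha>)) powr 1"
      using \<open>1 \<le> l\<close> \<open>0 < \<alpha>\<close> q1
      by (intro powr_mono') (auto simp: powr_minus inverse_le_1_iff ge_one_powr_ge_zero)
    then show "(l powr (- \<alpha>)) powr q \<le> l powr (- \<alpha>)" by simp
    have "real N * (real n powr (- \<theta>)) powr q \<le> real n ^ d * (real n powr (- \<theta>)) powr q"
      using \<open>N \<le> n ^ d\<close> by (intro mult_right_mono) (simp_all add: of_nat_power[symmetric] del: of_nat_power)
    also have "\<dots> = real n powr d * real n powr (- real d)"
      using n1 \<open>0 < \<theta>\<close> by (simp add: powr_powr q powr_realpow)
    also have "\<dots> = 1" using n1 by (simp add: powr_add[symmetric])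
    finally show "N * (real n powr (- \<theta>)) powr q \<le> 1" .
  qed auto
  finally have small_jumps: "N * (2 * exp 1 * (A * l powr (- \<alpha>) * real n powr (- \<theta>)) powr q)
      \<le> 2 * exp 1 * A powr q * l powr (- \<alpha>)" by simp
  have A: "8 * (2 powr \<alpha> * (D + 1)) * ((2 * q) powr \<alpha> * l powr (- \<alpha>) * real n powr (- \<theta>))
      = A * l powr (- \<alpha>) * real n powr (- \<theta>)"
    by (simp only: A_def mult.assoc)
  show ?thesis
    unfolding ratio A distrib_right[of _ _ "l powr (- \<alpha>)"] by (rule add_mono[OF big_jumps small_jumps])
qed

section \<open>The moment bound\<close>

theorem theorem3p3:
  fixes \<alpha> \<beta> \<theta>\<^sub>2 :: real
    and P :: "'w measure" and Y :: "int ^ 'n \<Rightarrow> 'w \<Rightarrow> real"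
    and \<mu> :: "'s measure" and \<phi> :: "int ^ 'n \<Rightarrow> 's \<Rightarrow> 's"
    and c :: "int ^ 'n \<Rightarrow> 's \<Rightarrow> real" and f :: "'s \<Rightarrow> real"
    and Q :: "'v measure" and M :: "'s set \<Rightarrow> 'v \<Rightarrow> real"
    and X :: "int ^ 'n \<Rightarrow> 'v \<Rightarrow> real"
  assumes "0 < \<alpha>" "\<alpha> < 2"
    and "prob_space P" and "sas_field \<alpha> P Y" and "stationary P Y"
    and "standard_borel \<mu>" and "sigma_finite_measure \<mu>"
    and "in_Lalpha \<alpha> \<mu> f"
    and "nonsingular_action \<mu> \<phi>" and "sign_cocycle \<mu> \<phi> c"
    and "full_support \<mu> \<phi> f"
    and "prob_space Q" and "sas_random_measure \<alpha> \<mu> Q M"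
    and "\<And>t. is_stable_integral \<alpha> \<mu> Q M (action_kernel \<alpha> \<mu> \<phi> c f t) (X t)"
    and "same_fdd P Y Q X"
    and "0 < \<beta>" "\<beta> < \<alpha>"
    and "weak_effective_dimension_le \<alpha> \<mu> (action_kernel \<alpha> \<mu> \<phi> c f) \<theta>\<^sub>2"
  shows "\<exists>K'::real. \<forall>n\<ge>1.
           ennreal (real n powr (- (\<theta>\<^sub>2 * \<beta> / \<alpha>))) * (\<integral>\<^sup>+ \<omega>. ennreal (partial_max Y n \<omega> powr \<beta>) \<partial>P)
             \<le> ennreal K'"
proof -
  let ?k = "action_kernel \<alpha> \<mu> \<phi> c f" and ?d = "CARD('n)"
  note \<alpha> = assms(1,2)
  interpret P: prob_space P by fact
  interpret Q: prob_space Q by fact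
  have \<theta>: "0 < \<theta>\<^sub>2" "\<theta>\<^sub>2 \<le> real ?d"
    using assms(18) by (simp_all add: weak_effective_dimension_le_def)
  have "\<exists>c\<^sub>2>0. \<forall>\<^sub>F n in sequentially. b_seq \<alpha> \<mu> ?k n powr \<alpha> \<le> c\<^sub>2 * real n powr \<theta>\<^sub>2"
    using assms(18) unfolding weak_effective_dimension_le_def eventually_conj_iff by blast
  then obtain c\<^sub>2 where c2: "0 < c\<^sub>2"
    and b_ev: "\<forall>\<^sub>F n in sequentially. b_seq \<alpha> \<mu> ?k n powr \<alpha> \<le> c\<^sub>2 * real n powr \<theta>\<^sub>2"
    by blast
  define D where "D = (\<integral>s. \<bar>f s\<bar> powr \<alpha> \<partial>\<mu>)"
  have D: "0 \<le> D" by (simp add: D_def integral_nonneg)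
  have k_norm: "(\<integral>\<^sup>+ s. ennreal (\<bar>?k t s\<bar> powr \<alpha>) \<partial>\<mu>) \<le> ennreal D" for t
  proof -
    have "(\<integral>\<^sup>+ s. ennreal (\<bar>?k t s\<bar> powr \<alpha>) \<partial>\<mu>) \<le> (\<integral>\<^sup>+ s. ennreal (\<bar>f s\<bar> powr \<alpha>) \<partial>\<mu>)"
      by (rule action_kernel_norm_le[OF assms(1,7,8,9,10)])
    also have "\<dots> = ennreal D"
      unfolding D_def using assms(8) by (intro nn_integral_eq_integral) (auto simp: in_Lalpha_def)
    finally show ?thesis .
  qed
  have k_meas[measurable]: "?k t \<in> borel_measurable \<mu>" for t
    using assms(14)[of t] by (simp add: is_stable_integral_def in_Lalpha_def)
  have X_meas[measurable]: "X t \<in> borel_measurable Q" for t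
    using assms(14)[of t] by (simp add: is_stable_integral_def)
  have Y_meas: "Y t \<in> borel_measurable P" for t
    using assms(4) by (simp add: sas_field_def)
  note b = nn_integral_Max_kernel[of \<alpha> _ ?k \<mu> D, OF \<alpha>(1) _ k_meas k_norm D]
  obtain C where C: "0 \<le> C" and b_le: "\<And>n. 1 \<le> n \<Longrightarrow> b_seq \<alpha> \<mu> ?k n powr \<alpha> \<le> C * real n powr \<theta>\<^sub>2"
    using eventually_powr_bound_imp_bound[OF b_ev c2 less_imp_le[OF \<theta>(1)] D b(2)] by blast
  define q where "q = real ?d / \<theta>\<^sub>2"
  have q: "0 < q" using \<theta> by (simp add: q_def)
  define K where "K = 8 * (2 powr \<alpha> * (C + 1)) * (2 * q) powr \<alpha>
    + 2 * exp 1 * (8 * (2 powr \<alpha> * (D + 1)) * (2 * q) powr \<alpha>) powr q"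
  have K: "0 \<le> K" using C by (simp add: K_def)
  have tail: "Q.prob {\<omega> \<in> space Q. l < partial_max X n \<omega> / real n powr (\<theta>\<^sub>2 / \<alpha>)} \<le> K * l powr (- \<alpha>)"
    if n: "1 \<le> n" and l: "1 \<le> l" for n l
  proof -
    let ?I = "cube n :: (int ^ 'n) set"
    define L where "L = l * real n powr (\<theta>\<^sub>2 / \<alpha>)"
    have L: "0 < L" using n l by (simp add: L_def)
    note fin = cube_finite_card(1)[where 'n = 'n, of n]
    have max_gr: "L < partial_max X n \<omega> \<longleftrightarrow> (\<exists>t\<in>?I. L < \<bar>X t \<omega>\<bar>)" for \<omega>
      unfolding partial_max_def using fin zero_in_cube[OF n, where 'n = 'n] by (subst Max_gr_iff) auto
    have "{\<omega> \<in> space Q. l < partial_max X n \<omega> / real n powr (\<theta>\<^sub>2 / \<alpha>)} = {\<omega> \<in> space Q. \<exists>t\<in>?I. L < \<bar>X t \<omega>\<bar>}"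
      using n by (simp add: max_gr pos_less_divide_eq L_def[symmetric])
    also have "Q.prob \<dots> \<le> 8 * (2 powr \<alpha> * (C * real n powr \<theta>\<^sub>2 + 1)) * (2 * q / L) powr \<alpha>
       + card ?I * (2 * exp 1 * (8 * (2 powr \<alpha> * (D + 1)) * (2 * q / L) powr \<alpha>) powr q)"
    proof (rule stable_integral_max_tail[OF \<alpha> Q.prob_space_axioms assms(13) fin])
      let ?G = "\<lambda>s. ennreal (Max ((\<lambda>t. \<bar>?k t s\<bar> powr \<alpha>) ` ?I))"
      show "?G \<in> borel_measurable \<mu>"
        by (intro measurable_compose[OF _ measurable_ennreal] borel_measurable_Max[OF fin]) measurable
      show "ennreal (\<bar>?k t s\<bar> powr \<alpha>) \<le> ?G s" if "t \<in> ?I" for t s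
        using that fin by (intro ennreal_leI Max_ge) auto
      show "(\<integral>\<^sup>+ s. ?G s \<partial>\<mu>) \<le> ennreal (C * real n powr \<theta>\<^sub>2)"
        unfolding b(1)[OF n] by (rule ennreal_leI[OF b_le[OF n]])
    qed (use C D q L assms(14) k_norm in auto)
    also have "\<dots> \<le> K * l powr (- \<alpha>)"
      unfolding K_def L_def
      by (rule max_tail_rate[OF \<alpha>(1) \<theta> C D l n cube_finite_card(2) q_def])
    finally show ?thesis .
  qed
  have "ennreal (real n powr (- (\<theta>\<^sub>2 * \<beta> / \<alpha>))) * (\<integral>\<^sup>+ \<omega>. ennreal (partial_max Y n \<omega> powr \<beta>) \<partial>P)
      \<le> ennreal (1 + 2 powr \<beta> * K / (1 - 2 powr (\<beta> - \<alpha>)))" if n: "1 \<le> n" for n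
  proof -
    let ?W = "\<lambda>\<omega>. partial_max X n \<omega> / real n powr (\<theta>\<^sub>2 / \<alpha>)"
    note fin = cube_finite_card(1)[where 'n = 'n, of n]
    have max_meas[measurable]: "partial_max X n \<in> borel_measurable Q"
      unfolding partial_max_def[abs_def] by (rule borel_measurable_Max[OF fin]) measurable
    have max_nonneg: "0 \<le> partial_max X n \<omega>" for \<omega>
      unfolding partial_max_def using fin zero_in_cube[OF n, where 'n = 'n]
      by (subst Max_ge_iff) auto
    have "ennreal (real n powr (- (\<theta>\<^sub>2 * \<beta> / \<alpha>))) * (\<integral>\<^sup>+ \<omega>. ennreal (partial_max Y n \<omega> powr \<beta>) \<partial>P)
        = ennreal (real n powr (- (\<theta>\<^sub>2 * \<beta> / \<alpha>))) * (\<integral>\<^sup>+ \<omega>. ennreal (partial_max X n \<omega> powr \<beta>) \<partial>Q)"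
      by (simp only: same_fdd_partial_max_moment[OF assms(15) Y_meas X_meas])
    also have "\<dots> = (\<integral>\<^sup>+ \<omega>. ennreal (real n powr (- (\<theta>\<^sub>2 * \<beta> / \<alpha>))) * ennreal (partial_max X n \<omega> powr \<beta>) \<partial>Q)"
      by (rule nn_integral_cmult[symmetric]) measurable
    also have "\<dots> = (\<integral>\<^sup>+ \<omega>. ennreal (?W \<omega> powr \<beta>) \<partial>Q)"
    proof (rule nn_integral_cong)
      fix \<omega>
      have "?W \<omega> powr \<beta> = partial_max X n \<omega> powr \<beta> / (real n powr (\<theta>\<^sub>2 / \<alpha>)) powr \<beta>"
        by (rule powr_divide)
      also have "\<dots> = real n powr (- (\<theta>\<^sub>2 * \<beta> / \<alpha>)) * partial_max X n \<omega> powr \<beta>"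
        by (simp add: powr_powr powr_minus divide_inverse mult_ac)
      finally show "ennreal (real n powr (- (\<theta>\<^sub>2 * \<beta> / \<alpha>))) * ennreal (partial_max X n \<omega> powr \<beta>) = ennreal (?W \<omega> powr \<beta>)"
        by (simp add: ennreal_mult')
    qed
    also have "\<dots> \<le> ennreal (1 + 2 powr \<beta> * K / (1 - 2 powr (\<beta> - \<alpha>)))"
    proof (rule Q.moment_bound_from_tail[OF _ _ assms(16,17) K])
      show "?W \<in> borel_measurable Q" by measurable
    qed (use max_nonneg tail[OF n] in auto)
    finally show ?thesis .
  qed
  then show ?thesis by blast
qed

end
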